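(* Suppose $\gamma>0$. Then the $\mathbb{R}^{2N}$-valued process $\tilde Z=(\tilde Z(t))_{t\in[0,\infty)}$, $\tilde Z(t)=(Q(t),\,p(t)-u\mathbf{1})^\top$, converges weakly (in distribution) as $t\to\infty$ to a Gaussian distribution on $\mathbb{R}^{2N}$ with mean vector $\begin{bmatrix}\frac{L}{N}\mathbf{1} & 0\end{bmatrix}^\top\in\mathbb{R}^{2N}$, i.e. whose first $N$ components equal $L/N$ and whose last $N$ components equal $0$.
   Context: Parameters: $N\in\{3,4,\dots\}$ (number of agents), $L$ (length of the periodic segment), $\alpha,\beta\in(0,\infty)$, $\gamma\in[0,\infty)$, $\sigma\in\mathbb{R}$, $u\in\mathbb{R}$. $\mathbf{1}\in\mathbb{R}^N$ is the all-ones vector and $I$ the $N\times N$ identity matrix. $W=(W_n)_{n=1}^N$ is an $N$-dimensional standard Brownian motion on a probability space $(\Omega,\mathcal F,\mathbb P)$. Indices of agents are cyclic: $n+1=1$ when $n=N$ and $n-1=N$ when $n=1$. Initial data: deterministic positions $0\le q_1(0)\le q_2(0)\le\dots\le q_N(0)\le L$ and velocities $p(0)=\mathfrak{p}\in\mathbb{R}^N$; the distances are $Q_n=q_{n+1}-q_n$ for $n\in\{1,\dots,N-1\}$ and $Q_N=L+q_1-q_N$, so the initial distance vector $Q(0)=\mathfrak{Q}\in[0,\infty)^N$ satisfies $\sum_{n=1}^N Q_n(0)=L$. Model: with the quadratic potential $U(x)=\frac12(\alpha x)^2$ (so $U'(x)=\alpha^2x$), the process $(Q,p)$ solves, for $t\in[0,\infty)$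 and $n\in\{1,\dots,N\}$, $$dQ_n(t)=(p_{n+1}(t)-p_n(t))\,dt,$$ $$dp_n(t)=\bigl(U'(Q_n(t))-U'(Q_{n-1}(t))\bigr)dt+\beta\bigl(p_{n+1}(t)-2p_n(t)+p_{n-1}(t)\bigr)dt+\gamma\bigl(u-p_n(t)\bigr)dt+\sigma\,dW_n(t),$$ with $Q(0)=\mathfrak{Q}$, $p(0)=\mathfrak{p}$. Equivalently, $\tilde Z(t)=(Q(t),p(t)-u\mathbf{1})^\top$ satisfies $d\tilde Z(t)=B\tilde Z(t)\,dt+G\,dW(t)$ with $$B=\begin{bmatrix}0&A\\-\alpha^2A^\top&-\beta A^\top A-\gamma I\end{bmatrix}\in\mathbb{R}^{2N\times 2N},\qquad G=\begin{bmatrix}0\\ \sigma I\end{bmatrix}\in\mathbb{R}^{2N\times N},$$ where $A\in\mathbb{R}^{N\times N}$ has $A_{n,n}=-1$ for all $n$, $A_{n,n+1}=1$ for $n\in\{1,\dots,N-1\}$, $A_{N,1}=1$ and all other entries $0$. Convention: Gaussian distributions are allowed to be degenerate (singular covariance matrix). *)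

theory Defs
  imports "HOL-Probability.Probability"
begin

text \<open>
  \<open>N\<close> agents on a circular road are indexed by a finite linear order \<open>'n\<close> with
  \<open>N = CARD('n)\<close>: the agents \<open>1, \<dots>, N\<close> are the elements of \<open>'n\<close> in increasing order, so agent
  \<open>1\<close> is \<open>Min UNIV\<close> and agent \<open>N\<close> is \<open>Max UNIV\<close>. The numeral types \<open>3\<close>, \<open>4\<close>, \dots are instances.
  The cyclic shifts of the index are \<open>n + 1 = 1\<close> for \<open>n = N\<close> and \<open>n - 1 = N\<close> for \<open>n = 1\<close>.
\<close>

definition succ_agent :: "'n::{finite,linorder} \<Rightarrow> 'n" where
  "succ_agent n = (if n = Max UNIV then Min UNIV else Min {m. n < m})"

definition pred_agent :: "'n::{finite,linorder} \<Rightarrow> 'n" where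
  "pred_agent n = (if n = Min UNIV then Max UNIV else Max {m. m < n})"

lemma pred_succ_agent: "pred_agent (succ_agent n) = n"
proof (cases "n = Max UNIV")
  case True
  then show ?thesis by (simp add: succ_agent_def pred_agent_def)
next
  case False
  have "n < Max UNIV"
    using False by (simp add: order_less_le)
  then have ne: "{m. n < m} \<noteq> {}" by blast
  define s where "s = Min {m. n < m}"
  have ns: "n < s"
    using Min_in[OF _ ne] by (simp add: s_def)
  have le: "s \<le> m" if "n < m" for m
    using that by (simp add: s_def)
  have "Min UNIV \<le> n" by simp
  with ns have nmin: "s \<noteq> Min UNIV" by auto
  have "Max {m. m < s} = n"
  proof (rule Max_eqI)
    show "finite {m. m < s}" by simp
    show "n \<in> {m. m < s}" using ns by simp
    show "y \<le> n" if "y \<in> {m. m < s}" for y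
      using that le[of y] by (metis mem_Collect_eq not_le)
  qed
  with False nmin show ?thesis
    by (simp add: succ_agent_def pred_agent_def s_def)
qed

definition distances :: "real \<Rightarrow> (real, 'n::{finite,linorder}) vec \<Rightarrow> (real, 'n) vec" where
  "distances L q = (\<chi> n. if n = Max UNIV then L + q $ Min UNIV - q $ Max UNIV
                          else q $ succ_agent n - q $ n)"

definition quadratic_potential :: "real \<Rightarrow> real \<Rightarrow> real" where
  "quadratic_potential \<alpha> x = (\<alpha> * x)\<^sup>2 / 2"

text \<open>Brownian motion is indexed by \<open>real\<close>; only times \<open>t \<ge> 0\<close> are constrained.\<close>

definition standard_brownian_motion ::
  "'a measure \<Rightarrow> (real \<Rightarrow> 'a \<Rightarrow> real ^ 'n::finite) \<Rightarrow> bool" where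
  "standard_brownian_motion M W \<longleftrightarrow>
     prob_space M \<and>
     (\<forall>t\<ge>0. W t \<in> borel_measurable M) \<and>
     (AE \<omega> in M. W 0 \<omega> = 0) \<and>
     (AE \<omega> in M. continuous_on {0..} (\<lambda>t. W t \<omega>)) \<and>
     (\<forall>(k::nat) \<tau>. 0 \<le> \<tau> 0 \<and> (\<forall>i<k. \<tau> i < \<tau> (Suc i)) \<longrightarrow>
        prob_space.indep_vars M (\<lambda>_. borel) (\<lambda>i \<omega>. W (\<tau> (Suc i)) \<omega> - W (\<tau> i) \<omega>) {..<k}) \<and>
     (\<forall>s t. 0 \<le> s \<and> s < t \<longrightarrow>
        prob_space.indep_vars M (\<lambda>_. borel) (\<lambda>n \<omega>. (W t \<omega> - W s \<omega>) $ n) UNIV \<and>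
        (\<forall>n. distributed M lborel (\<lambda>\<omega>. (W t \<omega> - W s \<omega>) $ n) (normal_density 0 (sqrt (t - s)))))"

text \<open>
  Since the noise is additive and \<open>W 0 = 0\<close> almost surely, the stochastic integral of the constant
  \<open>\<sigma>\<close> against \<open>W\<close> over \<open>[0, t]\<close> is \<open>\<sigma> W t\<close>. The SDE is therefore the following integral equation
  for continuous paths. It determines the solution path by path, so the solution is adapted to the completed
  filtration of \<open>W\<close> without this being required.
\<close>

definition solves_agent_sde ::
  "'a measure \<Rightarrow> (real \<Rightarrow> 'a \<Rightarrow> (real, 'n::{finite,linorder}) vec) \<Rightarrow> (real \<Rightarrow> real) \<Rightarrow>
   real \<Rightarrow> real \<Rightarrow> real \<Rightarrow> real \<Rightarrow> (real, 'n) vec \<Rightarrow> (real, 'n) vec \<Rightarrow>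
   (real \<Rightarrow> 'a \<Rightarrow> (real, 'n) vec) \<Rightarrow> (real \<Rightarrow> 'a \<Rightarrow> (real, 'n) vec) \<Rightarrow> bool" where
  "solves_agent_sde M W U \<beta> \<gamma> \<sigma> u Q0 p0 Q p \<longleftrightarrow>
     (\<forall>t\<ge>0. Q t \<in> borel_measurable M \<and> p t \<in> borel_measurable M) \<and>
     (AE \<omega> in M.
        continuous_on {0..} (\<lambda>t. Q t \<omega>) \<and> continuous_on {0..} (\<lambda>t. p t \<omega>) \<and>
        (\<forall>t\<ge>0. \<forall>n.
           Q t \<omega> $ n = Q0 $ n + integral {0..t} (\<lambda>s. p s \<omega> $ succ_agent n - p s \<omega> $ n) \<and>
           p t \<omega> $ n = p0 $ n
             + integral {0..t} (\<lambda>s. (deriv U (Q s \<omega> $ n) - deriv U (Q s \<omega> $ pred_agent n))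
                 + \<beta> * (p s \<omega> $ succ_agent n - 2 * p s \<omega> $ n + p s \<omega> $ pred_agent n)
                 + \<gamma> * (u - p s \<omega> $ n))
             + \<sigma> * W t \<omega> $ n))"

text \<open>Zero variance is allowed, so Gaussian measures may be degenerate.\<close>

definition normal_distribution :: "real \<Rightarrow> real \<Rightarrow> real measure" where
  "normal_distribution m s =
     (if s = 0 then return borel m else density lborel (\<lambda>x. ennreal (normal_density m s x)))"

definition gaussian_measure :: "'b::euclidean_space measure \<Rightarrow> bool" where
  "gaussian_measure \<nu> \<longleftrightarrow>
     prob_space \<nu> \<and> sets \<nu> = sets borel \<and>
     (\<forall>v. \<exists>m s. 0 \<le> s \<and> distr \<nu> borel (\<lambda>x. x \<bullet> v) = normal_distribution m s)"

definition converges_in_distribution ::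
  "'a measure \<Rightarrow> ('i \<Rightarrow> 'a \<Rightarrow> 'b::topological_space) \<Rightarrow> 'b measure \<Rightarrow> 'i filter \<Rightarrow> bool" where
  "converges_in_distribution M X \<nu> F \<longleftrightarrow>
     (\<forall>f :: 'b \<Rightarrow> real. continuous_on UNIV f \<and> bounded (range f) \<longrightarrow>
        ((\<lambda>i. integral\<^sup>L (distr M borel (X i)) f) \<longlongrightarrow> integral\<^sup>L \<nu> f) F)"

end

theory Submission
  imports Defs
begin

text \<open>
  By variation of constants, the centred process is \<open>exp (t B) z0\<close> plus a linear functional of the
  Brownian path on \<open>[0, t]\<close>. The deterministic part tends to the equilibrium, because \<open>B\<close> vanishes
  on uniform distances and \<open>exp (t B)\<close> decays exponentially on distances with sum \<open>0\<close> (a Lyapunov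
  function with a cross term between velocities and distances). The noise part does not converge
  pathwise, but reversing time in the Brownian increments replaces it by
  \<open>\<integral> exp (s B) G dW(s)\<close> over \<open>[0, t]\<close>, which has the same law and which converges almost surely
  along every sequence \<open>t n \<ge> n\<close>. All these functionals are limits of linear combinations of
  increments, so their limit is Gaussian and centred.
\<close>

text \<open>The integrand \<open>exp (s B) G\<close> is deterministic and smooth, so integration by
  parts turns each stochastic integral into an ordinary integral over a continuous path. Its Riemann
  sums are linear in finitely many independent, identically distributed increments; there reversal
  is a mere permutation of indices, and the resulting identities of laws survive the passage to the
  limit. Reversal is an identity for each single time \<open>t\<close>, not for the process, which
  is all that convergence in distribution looks at. The obstacle on the deterministic side is that
  \<open>B\<close> is singular: uniform distances are stationary, so no decay estimate can hold on
  the whole space. Only the initial value leaves the decaying subspace, because the noise acts on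
  velocities alone and \<open>B\<close> always produces distances with sum \<open>0\<close>. The
  component that survives is the projection of the initial distances to uniform ones; their sum is
  \<open>L\<close>, whence the mean \<open>L / N\<close>.\<close>

section \<open>Exponentials of endomorphisms\<close>

text \<open>Bounded linear maps are copied to a type of their own because \<open>exp\<close> needs an instance of
  \<open>real_normed_algebra_1\<close>, which \<open>'a \<Rightarrow>\<^sub>L 'b\<close> with its two parameters cannot be.\<close>

typedef (overloaded) 'a endo = "UNIV :: ('a::real_normed_vector \<Rightarrow>\<^sub>L 'a) set"
  morphisms blinfun_of_endo endo_of_blinfun
  by simp

setup_lifting type_definition_endo

instantiation endo :: (real_normed_vector) real_normed_vector
begin
lift_definition zero_endo :: "'a endo" is 0 .
lift_definition plus_endo :: "'a endo \<Rightarrow> 'a endo \<Rightarrow> 'a endo" is "(+)" .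
lift_definition minus_endo :: "'a endo \<Rightarrow> 'a endo \<Rightarrow> 'a endo" is "(-)" .
lift_definition uminus_endo :: "'a endo \<Rightarrow> 'a endo" is uminus .
lift_definition scaleR_endo :: "real \<Rightarrow> 'a endo \<Rightarrow> 'a endo" is scaleR .
lift_definition norm_endo :: "'a endo \<Rightarrow> real" is norm .
definition sgn_endo :: "'a endo \<Rightarrow> 'a endo" where "sgn_endo x = scaleR (inverse (norm x)) x"
definition dist_endo :: "'a endo \<Rightarrow> 'a endo \<Rightarrow> real" where "dist_endo x y = norm (x - y)"
definition uniformity_endo :: "('a endo \<times> 'a endo) filter"
  where "uniformity_endo = (INF e\<in>{0 <..}. principal {(x, y). dist x y < e})"
definition open_endo :: "'a endo set \<Rightarrow> bool"
  where "open_endo S = (\<forall>x\<in>S. \<forall>\<^sub>F (x', y) in uniformity. x' = x \<longrightarrow> y \<in> S)"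
instance
  by standard (transfer; auto simp: algebra_simps norm_triangle_ineq sgn_endo_def dist_endo_def
    uniformity_endo_def open_endo_def)+
end

instantiation endo :: ("{real_normed_vector, perfect_space}") real_normed_algebra_1
begin
lift_definition one_endo :: "'a endo" is id_blinfun .
lift_definition times_endo :: "'a endo \<Rightarrow> 'a endo \<Rightarrow> 'a endo" is "(o\<^sub>L)" .
instance
proof
  \<comment> \<open>\<open>perfect_space\<close> excludes the trivial space, on which the identity
    would be \<open>0\<close>.\<close>
  show "(0::'a endo) \<noteq> 1"
    by transfer (metis norm_blinfun_id norm_zero zero_neq_one)
qed (transfer; auto intro!: blinfun_eqI simp: blinfun.bilinear_simps norm_blinfun_compose)+
end

instance endo :: ("{banach, perfect_space}") banach
proof
  fix X :: "nat \<Rightarrow> 'a endo"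
  assume "Cauchy X"
  then have "Cauchy (\<lambda>n. blinfun_of_endo (X n))"
    by (simp add: Cauchy_def dist_norm norm_endo.rep_eq minus_endo.rep_eq)
  then obtain l where "(\<lambda>n. blinfun_of_endo (X n)) \<longlonglongrightarrow> l"
    using Cauchy_convergent_iff convergent_def by blast
  then have "X \<longlonglongrightarrow> endo_of_blinfun l"
    by (simp add: LIMSEQ_def dist_norm norm_endo.rep_eq minus_endo.rep_eq endo_of_blinfun_inverse)
  then show "convergent X"
    by (auto simp: convergent_def)
qed

definition endo_apply :: "'a::real_normed_vector endo \<Rightarrow> 'a \<Rightarrow> 'a" (infixr "\<cdot>\<^sub>E" 75)
  where "F \<cdot>\<^sub>E v = blinfun_apply (blinfun_of_endo F) v"

lemma bounded_bilinear_endo_apply: "bounded_bilinear (\<cdot>\<^sub>E)"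
proof
  show "\<exists>K. \<forall>a b. norm (a \<cdot>\<^sub>E b) \<le> norm (a::'a endo) * norm b * K"
    by (intro exI[of _ 1]) (simp add: endo_apply_def norm_endo.rep_eq norm_blinfun)
qed (simp_all add: endo_apply_def plus_endo.rep_eq scaleR_endo.rep_eq blinfun.bilinear_simps)

interpretation endo: bounded_bilinear "(\<cdot>\<^sub>E)"
  by (rule bounded_bilinear_endo_apply)

lemma norm_endo_apply: "norm (F \<cdot>\<^sub>E v) \<le> norm F * norm v"
  by (simp add: endo_apply_def norm_endo.rep_eq norm_blinfun)

lemma endo_apply_one [simp]: "1 \<cdot>\<^sub>E v = v"
  and endo_apply_times: "(F * G) \<cdot>\<^sub>E v = F \<cdot>\<^sub>E G \<cdot>\<^sub>E v"
  by (simp_all add: endo_apply_def one_endo.rep_eq times_endo.rep_eq)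

definition Endo :: "('a::real_normed_vector \<Rightarrow> 'a) \<Rightarrow> 'a endo"
  where "Endo f = endo_of_blinfun (Blinfun f)"

lemma Endo_apply: "bounded_linear f \<Longrightarrow> Endo f \<cdot>\<^sub>E v = f v"
  by (simp add: Endo_def endo_apply_def endo_of_blinfun_inverse bounded_linear_Blinfun_apply)

section \<open>Exponentials as flows of linear differential equations\<close>

definition flow :: "'a::{banach, perfect_space} endo \<Rightarrow> real \<Rightarrow> 'a endo"
  where "flow B t = exp (t *\<^sub>R B)"

lemma flow_0 [simp]: "flow B 0 = 1"
  by (simp add: flow_def)

lemma flow_has_vector_derivative:
  "(flow B has_vector_derivative flow B t * B) (at t within S)"
  unfolding flow_def by (rule exp_scaleR_has_vector_derivative_right)

lemma flow_commute: "flow B t * B = B * flow B t"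
  unfolding flow_def by (rule exp_times_scaleR_commute)

lemma continuous_on_flow [continuous_intros]:
  "continuous_on S g \<Longrightarrow> continuous_on S (\<lambda>x. flow B (g x))"
  using continuous_on_compose2[OF continuous_on_vector_derivative[OF flow_has_vector_derivative]]
  by blast

lemma flow_apply_has_vector_derivative:
  "((\<lambda>t. flow B t \<cdot>\<^sub>E v) has_vector_derivative B \<cdot>\<^sub>E flow B t \<cdot>\<^sub>E v) (at t within S)"
  using bounded_linear.has_vector_derivative[OF endo.bounded_linear_left
      flow_has_vector_derivative[of B t S], of v]
  by (simp add: flow_commute endo_apply_times)

lemma flow_reflect_has_vector_derivative:
  "((\<lambda>s. flow B (T - s)) has_vector_derivative - (flow B (T - s) * B)) (at s within S)"
proof -
  have "((\<lambda>s. T - s) has_real_derivative - 1) (at s within S)"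
    by (auto intro!: derivative_eq_intros)
  from vector_diff_chain_within[OF this[unfolded has_real_derivative_iff_has_vector_derivative]
    flow_has_vector_derivative] show ?thesis
    by (simp add: o_def)
qed

text \<open>Variation of constants; subtracting the noise \<open>g\<close> from \<open>z\<close> leaves a path that can be
  differentiated.\<close>

lemma duhamel:
  fixes z g :: "real \<Rightarrow> 'a::{banach, perfect_space}"
  assumes "0 \<le> T"
    and z: "continuous_on {0..T} z" and g: "continuous_on {0..T} g"
    and eq: "\<And>t. t \<in> {0..T} \<Longrightarrow> z t = z0 + integral {0..t} (\<lambda>s. B \<cdot>\<^sub>E z s) + g t"
  shows "z T = flow B T \<cdot>\<^sub>E z0 + g T + integral {0..T} (\<lambda>s. flow B (T - s) \<cdot>\<^sub>E B \<cdot>\<^sub>E g s)"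
proof -
  define x where "x t = z0 + integral {0..t} (\<lambda>s. B \<cdot>\<^sub>E z s)" for t
  have cont: "continuous_on {0..T} (\<lambda>s. B \<cdot>\<^sub>E z s)"
    by (intro bounded_linear.continuous_on[OF endo.bounded_linear_right] z)
  have x': "(x has_vector_derivative B \<cdot>\<^sub>E z s) (at s within {0..T})" if "s \<in> {0..T}" for s
    using has_vector_derivative_add[OF has_vector_derivative_const
        integral_has_vector_derivative[OF cont that], of z0]
    by (simp add: x_def[abs_def])
  \<comment> \<open>In the product rule the generator acts once on \<open>z s\<close> and once, with
    opposite sign, on \<open>x s\<close>. Since \<open>z = x + g\<close>, only the forcing by
    \<open>B\<close> applied to \<open>g s\<close> survives.\<close>
  have "((\<lambda>s. flow B (T - s) \<cdot>\<^sub>E x s) has_vector_derivative flow B (T - s) \<cdot>\<^sub>E B \<cdot>\<^sub>E g s)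
      (at s within {0..T})" if s: "s \<in> {0..T}" for s
  proof -
    have "((\<lambda>s. flow B (T - s) \<cdot>\<^sub>E x s) has_vector_derivative
      flow B (T - s) \<cdot>\<^sub>E B \<cdot>\<^sub>E z s + (- (flow B (T - s) * B)) \<cdot>\<^sub>E x s) (at s within {0..T})"
      by (rule bounded_bilinear.has_vector_derivative[OF bounded_bilinear_endo_apply
          flow_reflect_has_vector_derivative x'[OF s]])
    moreover have "z s = x s + g s"
      using eq[OF s] by (simp add: x_def)
    ultimately show ?thesis
      by (simp add: endo_apply_times endo.add_right endo.minus_left)
  qed
  from fundamental_theorem_of_calculus[OF \<open>0 \<le> T\<close> this]
  have "integral {0..T} (\<lambda>s. flow B (T - s) \<cdot>\<^sub>E B \<cdot>\<^sub>E g s) = x T - flow B T \<cdot>\<^sub>E x 0"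
    by (simp add: integral_unique)
  moreover have "x 0 = z0" "z T = x T + g T"
    using eq[of T] \<open>0 \<le> T\<close> by (simp_all add: x_def)
  ultimately show ?thesis
    by (simp add: algebra_simps)
qed

section \<open>Exponential decay of the cyclic drift\<close>

lemma bij_succ_agent: "bij (succ_agent :: 'n::{finite,linorder} \<Rightarrow> 'n)"
proof -
  have "inj (succ_agent :: 'n \<Rightarrow> 'n)"
    by (rule inj_on_inverseI[where g=pred_agent]) (simp add: pred_succ_agent)
  then show ?thesis
    by (simp add: bij_def finite_UNIV_inj_surj)
qed

lemma succ_pred_agent: "succ_agent (pred_agent n) = n"
  by (metis bij_succ_agent bij_pointE pred_succ_agent)

lemma sum_succ_agent: "(\<Sum>n\<in>UNIV. f (succ_agent n)) = (\<Sum>n\<in>UNIV. f n)"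
  by (rule sum.reindex_bij_betw[OF bij_succ_agent])

text \<open>A least index with a deviating value is not \<open>Min UNIV\<close>, so its predecessor
  is strictly smaller and has the regular value; invariance passes that value on to the index
  itself. This identifies the kernel of \<open>backward_diff\<close>.\<close>

lemma pred_agent_invariant_imp_const:
  fixes f :: "'n::{finite,linorder} \<Rightarrow> 'b"
  assumes inv: "\<And>n. f (pred_agent n) = f n"
  shows "f n = f (Min UNIV)"
proof (rule ccontr)
  assume "f n \<noteq> f (Min UNIV)"
  then have ne: "{m. f m \<noteq> f (Min UNIV)} \<noteq> {}" by blast
  define s where "s = Min {m. f m \<noteq> f (Min UNIV)}"
  have s: "f s \<noteq> f (Min UNIV)"
    using Min_in[OF _ ne] by (simp add: s_def)
  then have smin: "s \<noteq> Min UNIV" by auto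
  moreover have "Min UNIV \<le> s" by simp
  ultimately have "Min UNIV \<in> {m. m < s}" by (metis le_neq_trans mem_Collect_eq)
  then have "{m. m < s} \<noteq> {}" by blast
  from Max_in[OF _ this] have "pred_agent s < s"
    using smin by (simp add: pred_agent_def)
  then have "f (pred_agent s) = f (Min UNIV)"
    by (metis (mono_tags, lifting) Min_le finite linorder_not_less mem_Collect_eq s_def)
  with s inv show False by simp
qed

text \<open>\<open>forward_diff\<close> is the matrix A of the model and
  \<open>backward_diff\<close> its transpose, including the sign.\<close>

definition forward_diff :: "(real, 'n::{finite,linorder}) vec \<Rightarrow> (real, 'n) vec"
  where "forward_diff p = (\<chi> n. p $ succ_agent n - p $ n)"

definition backward_diff :: "(real, 'n::{finite,linorder}) vec \<Rightarrow> (real, 'n) vec"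
  where "backward_diff q = (\<chi> n. q $ pred_agent n - q $ n)"

lemma bounded_linear_forward_diff: "bounded_linear forward_diff"
  and bounded_linear_backward_diff: "bounded_linear backward_diff"
  by (auto intro!: linear_conv_bounded_linear[THEN iffD1] linearI
      simp: forward_diff_def backward_diff_def vec_eq_iff algebra_simps)

lemmas diff_simps =
  linear_add[OF bounded_linear.linear[OF bounded_linear_forward_diff]]
  linear_add[OF bounded_linear.linear[OF bounded_linear_backward_diff]]
  linear_scale[OF bounded_linear.linear[OF bounded_linear_forward_diff]]
  linear_scale[OF bounded_linear.linear[OF bounded_linear_backward_diff]]
  linear_0[OF bounded_linear.linear[OF bounded_linear_forward_diff]]
  linear_0[OF bounded_linear.linear[OF bounded_linear_backward_diff]]

lemma forward_diff_adjoint: "forward_diff p \<bullet> q = p \<bullet> backward_diff q"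
  using sum_succ_agent[of "\<lambda>n. p $ n * q $ pred_agent n"]
  by (simp add: forward_diff_def backward_diff_def inner_vec_def algebra_simps sum_subtractf
      pred_succ_agent)

lemma sum_forward_diff: "(\<Sum>n\<in>UNIV. forward_diff p $ n) = 0"
  using sum_succ_agent[of "($) p"] by (simp add: forward_diff_def sum_subtractf)

text \<open>A discrete Poincare inequality. Vectors killed by \<open>backward_diff\<close> are
  constant, and a constant vector with sum \<open>0\<close> vanishes; an injective linear map on a
  closed finite-dimensional subspace is bounded below there. The constant is not explicit.\<close>

lemma backward_diff_poincare:
  "\<exists>\<kappa>>0. \<forall>q :: (real, 'n::{finite,linorder}) vec.
     (\<Sum>n\<in>UNIV. q $ n) = 0 \<longrightarrow> \<kappa> * norm q \<le> norm (backward_diff q)"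
proof -
  let ?S = "{q :: (real, 'n) vec. (\<Sum>n\<in>UNIV. q $ n) = 0}"
  have "subspace ?S"
    by (auto simp: subspace_def sum.distrib sum_distrib_left[symmetric])
  moreover have "q = 0" if "q \<in> ?S" "backward_diff q = 0" for q :: "(real, 'n) vec"
  proof -
    from that(2) have "q $ pred_agent n = q $ n" for n
      by (simp add: backward_diff_def vec_eq_iff)
    then have const: "q $ n = q $ Min UNIV" for n
      by (rule pred_agent_invariant_imp_const)
    have "(\<Sum>n\<in>UNIV. q $ n) = (\<Sum>n\<in>(UNIV :: 'n set). q $ Min UNIV)"
      by (rule sum.cong[OF refl const])
    with that(1) have "q $ Min UNIV = 0"
      by simp
    then show "q = 0"
      by (subst vec_eq_iff, subst const) simp
  qed
  ultimately show ?thesis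
    using injective_imp_isometric[of ?S backward_diff] closed_subspace[of ?S]
      bounded_linear_backward_diff
    by (auto simp: mult.commute)
qed

text \<open>The block matrix B of the model, acting on the distances and the velocities centred at
  \<open>u\<close>.\<close>

definition drift :: "real \<Rightarrow> real \<Rightarrow> real \<Rightarrow>
    (real, 'n::{finite,linorder}) vec \<times> (real, 'n) vec \<Rightarrow> (real, 'n) vec \<times> (real, 'n) vec"
  where "drift \<alpha> \<beta> \<gamma> z = (forward_diff (snd z),
    - (\<alpha>\<^sup>2 *\<^sub>R backward_diff (fst z)) - \<beta> *\<^sub>R backward_diff (forward_diff (snd z)) - \<gamma> *\<^sub>R snd z)"

lemma bounded_linear_drift: "bounded_linear (drift \<alpha> \<beta> \<gamma>)"
  by (intro linear_conv_bounded_linear[THEN iffD1] linearI)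
     (auto simp: drift_def diff_simps algebra_simps)

lemma drift_uniform [simp]: "drift \<alpha> \<beta> \<gamma> ((\<chi> n. c), 0) = 0"
  by (simp add: drift_def diff_simps) (simp add: backward_diff_def vec_eq_iff prod_eq_iff)

abbreviation drift_flow :: "real \<Rightarrow> real \<Rightarrow> real \<Rightarrow> real \<Rightarrow>
    ((real, 'n::{finite,linorder}) vec \<times> (real, 'n) vec) endo"
  where "drift_flow \<alpha> \<beta> \<gamma> \<equiv> flow (Endo (drift \<alpha> \<beta> \<gamma>))"

lemma drift_flow_has_vector_derivative:
  "((\<lambda>t. drift_flow \<alpha> \<beta> \<gamma> t \<cdot>\<^sub>E v) has_vector_derivative drift \<alpha> \<beta> \<gamma> (drift_flow \<alpha> \<beta> \<gamma> t \<cdot>\<^sub>E v))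
    (at t within S)"
  using flow_apply_has_vector_derivative[of "Endo (drift \<alpha> \<beta> \<gamma>)" v t S]
  by (simp add: Endo_apply bounded_linear_drift)

lemma vector_derivative_zero_imp_eq:
  fixes f :: "real \<Rightarrow> 'a::real_normed_vector"
  assumes "\<And>t. (f has_vector_derivative 0) (at t)"
  shows "f s = f t"
proof -
  obtain c where "\<And>t. t \<in> UNIV \<Longrightarrow> f t = c"
    using has_vector_derivative_zero_constant[OF convex_UNIV, of f] assms by auto
  then show ?thesis by simp
qed

text \<open>The flow commutes with its generator, so on a vector of the kernel its derivative is the
  flow applied to \<open>0\<close>. This allows the equilibrium to be subtracted from the initial
  value.\<close>

lemma drift_flow_uniform:
  "drift_flow \<alpha> \<beta> \<gamma> t \<cdot>\<^sub>E ((\<chi> n. c), 0) = ((\<chi> n. c), 0)"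
  (is "flow ?B t \<cdot>\<^sub>E ?v = _")
proof -
  have "((\<lambda>t. flow ?B t \<cdot>\<^sub>E ?v) has_vector_derivative 0) (at t)" for t
  proof -
    have "?B \<cdot>\<^sub>E flow ?B t \<cdot>\<^sub>E ?v = flow ?B t \<cdot>\<^sub>E ?B \<cdot>\<^sub>E ?v"
      by (simp add: flow_commute flip: endo_apply_times)
    also have "\<dots> = 0"
      by (simp add: Endo_apply bounded_linear_drift endo.zero_right)
    finally show ?thesis
      using flow_apply_has_vector_derivative[of ?B ?v t UNIV] by simp
  qed
  then have "flow ?B t \<cdot>\<^sub>E ?v = flow ?B 0 \<cdot>\<^sub>E ?v"
    by (rule vector_derivative_zero_imp_eq)
  then show ?thesis by simp
qed

text \<open>Forward differences around the cycle cancel, so the total distance is conserved. Thus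
  the Poincare inequality remains available along the whole trajectory.\<close>

lemma drift_flow_sum_fst:
  assumes "(\<Sum>n\<in>UNIV. fst v $ n) = 0"
  shows "(\<Sum>n\<in>UNIV. fst (drift_flow \<alpha> \<beta> \<gamma> t \<cdot>\<^sub>E v) $ n) = 0"
proof -
  let ?l = "\<lambda>z :: (real, 'a) vec \<times> (real, 'a) vec. \<Sum>n\<in>UNIV. fst z $ n"
  have l: "bounded_linear ?l"
    by (intro linear_conv_bounded_linear[THEN iffD1] linearI)
       (auto simp: sum.distrib sum_distrib_left)
  have "((\<lambda>t. ?l (drift_flow \<alpha> \<beta> \<gamma> t \<cdot>\<^sub>E v)) has_vector_derivative 0) (at t)" for t
    using bounded_linear.has_vector_derivative[OF l drift_flow_has_vector_derivative, of \<alpha> \<beta> \<gamma> v t UNIV]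
    by (simp add: drift_def sum_forward_diff)
  then have "?l (drift_flow \<alpha> \<beta> \<gamma> t \<cdot>\<^sub>E v) = ?l (drift_flow \<alpha> \<beta> \<gamma> 0 \<cdot>\<^sub>E v)"
    by (rule vector_derivative_zero_imp_eq)
  then show ?thesis using assms by simp
qed

section \<open>A Lyapunov function for the damped cycle\<close>

text \<open>The energy alone only dissipates through the velocities; the cross term with
  \<open>backward_diff (fst z)\<close> makes the distances contribute to the dissipation.\<close>

definition lyapunov :: "real \<Rightarrow> real \<Rightarrow> (real, 'n::{finite,linorder}) vec \<times> (real, 'n) vec \<Rightarrow> real"
  where "lyapunov \<alpha> \<epsilon> z = \<alpha>\<^sup>2 * (fst z \<bullet> fst z) + snd z \<bullet> snd z
    + 2 * \<epsilon> * (snd z \<bullet> backward_diff (fst z))"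

text \<open>By adjointness the coupling of distances and velocities cancels in the energy, leaving
  the friction terms with \<beta> and \<gamma>. Differentiating the cross term yields the
  dissipation in \<open>backward_diff q\<close>, together with two mixed terms of no definite sign
  and the harmful square of \<open>forward_diff p\<close>.\<close>

lemma lyapunov_has_real_derivative:
  "((\<lambda>t. lyapunov \<alpha> \<epsilon> (drift_flow \<alpha> \<beta> \<gamma> t \<cdot>\<^sub>E v)) has_real_derivative
    (let q = fst (drift_flow \<alpha> \<beta> \<gamma> t \<cdot>\<^sub>E v); p = snd (drift_flow \<alpha> \<beta> \<gamma> t \<cdot>\<^sub>E v) in
     - 2 * \<beta> * (forward_diff p \<bullet> forward_diff p) - 2 * \<gamma> * (p \<bullet> p)
     + 2 * \<epsilon> * (- \<alpha>\<^sup>2 * (backward_diff q \<bullet> backward_diff q)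
         - \<beta> * (backward_diff (forward_diff p) \<bullet> backward_diff q)
         - \<gamma> * (p \<bullet> backward_diff q) + forward_diff p \<bullet> forward_diff p))) (at t)"
proof -
  define z where "z t = drift_flow \<alpha> \<beta> \<gamma> t \<cdot>\<^sub>E v" for t
  have z: "(z has_vector_derivative drift \<alpha> \<beta> \<gamma> (z t)) (at t)" for t
    using drift_flow_has_vector_derivative[of \<alpha> \<beta> \<gamma> v t UNIV] by (simp add: z_def[abs_def])
  note q = bounded_linear.has_vector_derivative[OF bounded_linear_fst z[of t]]
  note p = bounded_linear.has_vector_derivative[OF bounded_linear_snd z[of t]]
  note bq = bounded_linear.has_vector_derivative[OF bounded_linear_backward_diff q]
  note inner = bounded_bilinear.has_vector_derivative[OF bounded_bilinear_inner]
  have "((\<lambda>t. lyapunov \<alpha> \<epsilon> (z t)) has_vector_derivative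
     \<alpha>\<^sup>2 *\<^sub>R (fst (z t) \<bullet> fst (drift \<alpha> \<beta> \<gamma> (z t)) + fst (drift \<alpha> \<beta> \<gamma> (z t)) \<bullet> fst (z t))
     + (snd (z t) \<bullet> snd (drift \<alpha> \<beta> \<gamma> (z t)) + snd (drift \<alpha> \<beta> \<gamma> (z t)) \<bullet> snd (z t))
     + (2 * \<epsilon>) *\<^sub>R (snd (z t) \<bullet> backward_diff (fst (drift \<alpha> \<beta> \<gamma> (z t)))
         + snd (drift \<alpha> \<beta> \<gamma> (z t)) \<bullet> backward_diff (fst (z t)))) (at t)"
    unfolding lyapunov_def real_scaleR_def[symmetric]
    by (intro has_vector_derivative_add inner q p bq
        bounded_linear.has_vector_derivative[OF bounded_linear_scaleR_right])
  moreover
  let ?q = "fst (z t)" and ?p = "snd (z t)"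
  have "forward_diff ?p \<bullet> ?q = ?p \<bullet> backward_diff ?q"
    "?q \<bullet> forward_diff ?p = ?p \<bullet> backward_diff ?q"
    "?p \<bullet> backward_diff (forward_diff ?p) = forward_diff ?p \<bullet> forward_diff ?p"
    "backward_diff (forward_diff ?p) \<bullet> ?p = forward_diff ?p \<bullet> forward_diff ?p"
    "backward_diff ?q \<bullet> ?p = ?p \<bullet> backward_diff ?q"
    by (simp_all add: forward_diff_adjoint[symmetric] inner_commute)
  ultimately show ?thesis
    unfolding has_real_derivative_iff_has_vector_derivative z_def[symmetric]
    by (elim has_vector_derivative_eq_rhs)
       (simp add: drift_def Let_def inner_diff_left inner_diff_right algebra_simps)
qed

text \<open>Young's inequality from the square of \<open>a / 2 - b\<close>. The weight 1/4 is chosen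
  because it is applied to two mixed terms, which together may use up only half of the dissipation
  in the distances.\<close>

lemma quadratic_le_sum_squares:
  fixes a b :: real
  shows "a * b \<le> a\<^sup>2 / 4 + b\<^sup>2"
  using zero_le_power2[of "a / 2 - b"] by (simp add: power2_eq_square algebra_simps)

text \<open>Here \<open>a\<close>, \<open>d\<close>, \<open>r\<close> stand for the norms of
  \<open>backward_diff q\<close>, \<open>forward_diff p\<close> and \<open>p\<close>, and
  \<open>x\<close>, \<open>y\<close> for the two mixed inner products. Young's inequality leaves
  half of the term in \<open>a\<close> intact. The first condition on \<epsilon> lets the
  \<beta>-friction absorb all terms in \<open>d\<close>, the second lets half of the
  \<gamma>-friction absorb those in \<open>r\<close>.\<close>

lemma lyapunov_dissipation:
  fixes a d r K :: real
  assumes "0 < \<alpha>" "0 < \<beta>" "0 < \<gamma>" "0 < \<epsilon>"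
    and eps: "\<epsilon> * (\<beta>\<^sup>2 * K\<^sup>2 / \<alpha>\<^sup>2 + 1) \<le> \<beta>" "2 * \<epsilon> * \<gamma> \<le> \<alpha>\<^sup>2"
    and x: "- x \<le> K * d * a" and y: "- y \<le> r * a"
  shows "- 2 * \<beta> * d\<^sup>2 - 2 * \<gamma> * r\<^sup>2 + 2 * \<epsilon> * (- \<alpha>\<^sup>2 * a\<^sup>2 - \<beta> * x - \<gamma> * y + d\<^sup>2)
    \<le> - \<gamma> * r\<^sup>2 - \<epsilon> * \<alpha>\<^sup>2 * a\<^sup>2"
proof -
  have "(\<alpha> * a) * (\<beta> * K * d / \<alpha>) \<le> (\<alpha> * a)\<^sup>2 / 4 + (\<beta> * K * d / \<alpha>)\<^sup>2"
    by (rule quadratic_le_sum_squares)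
  moreover have "(\<alpha> * a) * (\<beta> * K * d / \<alpha>) = \<beta> * (K * d * a)"
    using \<open>0 < \<alpha>\<close> by simp
  ultimately have 1: "- \<beta> * x \<le> \<alpha>\<^sup>2 * a\<^sup>2 / 4 + \<beta>\<^sup>2 * K\<^sup>2 / \<alpha>\<^sup>2 * d\<^sup>2"
    using mult_left_mono[OF x, of \<beta>] \<open>0 < \<beta>\<close> by (simp add: power_mult_distrib power_divide)
  have "(\<alpha> * a) * (\<gamma> * r / \<alpha>) \<le> (\<alpha> * a)\<^sup>2 / 4 + (\<gamma> * r / \<alpha>)\<^sup>2"
    by (rule quadratic_le_sum_squares)
  moreover have "(\<alpha> * a) * (\<gamma> * r / \<alpha>) = \<gamma> * (r * a)"
    using \<open>0 < \<alpha>\<close> by simp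
  ultimately have 2: "- \<gamma> * y \<le> \<alpha>\<^sup>2 * a\<^sup>2 / 4 + \<gamma>\<^sup>2 / \<alpha>\<^sup>2 * r\<^sup>2"
    using mult_left_mono[OF y, of \<gamma>] \<open>0 < \<gamma>\<close> by (simp add: power_mult_distrib power_divide)
  have "- \<alpha>\<^sup>2 * a\<^sup>2 - \<beta> * x - \<gamma> * y + d\<^sup>2
      \<le> - \<alpha>\<^sup>2 * a\<^sup>2 / 2 + (\<beta>\<^sup>2 * K\<^sup>2 / \<alpha>\<^sup>2 + 1) * d\<^sup>2 + \<gamma>\<^sup>2 / \<alpha>\<^sup>2 * r\<^sup>2"
    using 1 2 by (simp add: distrib_right)
  from mult_left_mono[OF this, of "2 * \<epsilon>"]
  have "2 * \<epsilon> * (- \<alpha>\<^sup>2 * a\<^sup>2 - \<beta> * x - \<gamma> * y + d\<^sup>2)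
      \<le> - \<epsilon> * \<alpha>\<^sup>2 * a\<^sup>2 + 2 * (\<epsilon> * (\<beta>\<^sup>2 * K\<^sup>2 / \<alpha>\<^sup>2 + 1)) * d\<^sup>2
        + 2 * \<epsilon> * \<gamma> * (\<gamma> / \<alpha>\<^sup>2) * r\<^sup>2"
    using \<open>0 < \<epsilon>\<close> by (simp add: algebra_simps power2_eq_square)
  moreover have "2 * (\<epsilon> * (\<beta>\<^sup>2 * K\<^sup>2 / \<alpha>\<^sup>2 + 1)) * d\<^sup>2 \<le> 2 * \<beta> * d\<^sup>2"
    using eps(1) by (intro mult_right_mono mult_left_mono) auto
  moreover have "2 * \<epsilon> * \<gamma> * (\<gamma> / \<alpha>\<^sup>2) * r\<^sup>2 \<le> \<alpha>\<^sup>2 * (\<gamma> / \<alpha>\<^sup>2) * r\<^sup>2"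
    using eps(2) \<open>0 < \<gamma>\<close> by (intro mult_right_mono) auto
  moreover have "\<alpha>\<^sup>2 * (\<gamma> / \<alpha>\<^sup>2) * r\<^sup>2 = \<gamma> * r\<^sup>2"
    using \<open>0 < \<alpha>\<close> by simp
  ultimately show ?thesis by linarith
qed

text \<open>For small \<epsilon> the cross term is at most half of the energy: Cauchy-Schwarz and
  the bound \<open>K\<close> reduce it to \<alpha> times a product of two norms, and the inequality
  of arithmetic and geometric means does the rest.\<close>

lemma lyapunov_equivalent:
  fixes z :: "(real, 'n::{finite,linorder}) vec \<times> (real, 'n) vec"
  assumes "0 < \<alpha>" "0 < \<epsilon>" "2 * \<epsilon> * K \<le> \<alpha>"
    and K: "\<And>q :: (real, 'n) vec. norm (backward_diff q) \<le> K * norm q"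
  defines "e \<equiv> \<alpha>\<^sup>2 * (norm (fst z))\<^sup>2 + (norm (snd z))\<^sup>2"
  shows "e / 2 \<le> lyapunov \<alpha> \<epsilon> z" "lyapunov \<alpha> \<epsilon> z \<le> 3 / 2 * e"
proof -
  let ?q = "norm (fst z)" and ?r = "norm (snd z)"
  have "\<bar>snd z \<bullet> backward_diff (fst z)\<bar> \<le> ?r * norm (backward_diff (fst z))"
    by (rule Cauchy_Schwarz_ineq2)
  also have "\<dots> \<le> ?r * (K * ?q)"
    by (intro mult_left_mono K) simp
  finally have "2 * \<epsilon> * \<bar>snd z \<bullet> backward_diff (fst z)\<bar> \<le> (2 * \<epsilon>) * (?r * (K * ?q))"
    using \<open>0 < \<epsilon>\<close> by (intro mult_left_mono) auto
  also have "\<dots> = (2 * \<epsilon> * K) * (?q * ?r)"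
    by simp
  also have "\<dots> \<le> \<alpha> * (?q * ?r)"
    using assms by (intro mult_right_mono) auto
  also have "\<dots> \<le> e / 2"
    using zero_le_power2[of "\<alpha> * ?q - ?r"] by (simp add: e_def power2_eq_square algebra_simps)
  finally have "\<bar>2 * \<epsilon> * (snd z \<bullet> backward_diff (fst z))\<bar> \<le> e / 2"
    using \<open>0 < \<epsilon>\<close> by (simp add: abs_mult)
  moreover have "lyapunov \<alpha> \<epsilon> z = e + 2 * \<epsilon> * (snd z \<bullet> backward_diff (fst z))"
    by (simp add: lyapunov_def e_def power2_norm_eq_inner)
  ultimately show "e / 2 \<le> lyapunov \<alpha> \<epsilon> z" "lyapunov \<alpha> \<epsilon> z \<le> 3 / 2 * e"
    by linarith+
qed

text \<open>Gronwall's argument: the integrating factor \<open>exp (c * t)\<close> makes the product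
  nonincreasing.\<close>

lemma exp_decay_of_derivative:
  fixes f :: "real \<Rightarrow> real"
  assumes f: "\<And>t. (f has_real_derivative f' t) (at t)" and le: "\<And>t. f' t \<le> - c * f t"
    and "0 \<le> t"
  shows "f t \<le> exp (- c * t) * f 0"
proof -
  have "exp (c * t) * f t \<le> exp (c * 0) * f 0"
  proof (rule DERIV_nonpos_imp_nonincreasing[OF \<open>0 \<le> t\<close>])
    fix s
    have "((\<lambda>s. exp (c * s) * f s) has_real_derivative exp (c * s) * (f' s + c * f s)) (at s)"
      by (auto intro!: derivative_eq_intros f simp: algebra_simps)
    moreover have "exp (c * s) * (f' s + c * f s) \<le> 0"
      using le[of s] by (intro mult_nonneg_nonpos) auto
    ultimately show "\<exists>y. ((\<lambda>s. exp (c * s) * f s) has_real_derivative y) (at s) \<and> y \<le> 0"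
      by blast
  qed
  then show ?thesis
    by (simp add: exp_minus field_simps)
qed

text \<open>The restriction to sum \<open>0\<close> cannot be dropped, since uniform distances are
  fixed by the flow. It enters through the Poincare inequality, which converts dissipation in
  distance differences into dissipation in the distances.\<close>

proposition drift_flow_decay:
  assumes pos: "0 < \<alpha>" "0 < \<beta>" "0 < \<gamma>"
  shows "\<exists>C>0. \<exists>c>0. \<forall>t\<ge>0. \<forall>v :: (real, 'n::{finite,linorder}) vec \<times> (real, 'n) vec.
    (\<Sum>n\<in>UNIV. fst v $ n) = 0 \<longrightarrow> norm (drift_flow \<alpha> \<beta> \<gamma> t \<cdot>\<^sub>E v) \<le> C * exp (- c * t) * norm v"
proof -
  obtain K where "0 < K" and K: "\<And>q :: (real, 'n) vec. norm (backward_diff q) \<le> K * norm q"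
    using bounded_linear.pos_bounded[OF bounded_linear_backward_diff] by (metis mult.commute)
  obtain \<kappa> where "0 < \<kappa>" and \<kappa>: "\<And>q :: (real, 'n) vec.
      (\<Sum>n\<in>UNIV. q $ n) = 0 \<Longrightarrow> \<kappa> * norm q \<le> norm (backward_diff q)"
    using backward_diff_poincare by blast
  define b where "b = \<beta>\<^sup>2 * K\<^sup>2 / \<alpha>\<^sup>2 + 1"
  have "0 < b"
    unfolding b_def by (intro add_nonneg_pos) auto
  \<comment> \<open>The first two bounds are the absorption conditions of
    \<open>lyapunov_dissipation\<close>; the third keeps the Lyapunov function comparable to the
    energy.\<close>
  define \<epsilon> where "\<epsilon> = Min {\<beta> / b, \<alpha>\<^sup>2 / (2 * \<gamma>), \<alpha> / (2 * K)}"
  have "0 < \<epsilon>"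
    using pos \<open>0 < b\<close> \<open>0 < K\<close> by (simp add: \<epsilon>_def)
  have "\<epsilon> \<le> \<beta> / b" "\<epsilon> \<le> \<alpha>\<^sup>2 / (2 * \<gamma>)" "\<epsilon> \<le> \<alpha> / (2 * K)"
    by (simp_all add: \<epsilon>_def)
  then have eps: "\<epsilon> * b \<le> \<beta>" "2 * \<epsilon> * \<gamma> \<le> \<alpha>\<^sup>2" "2 * \<epsilon> * K \<le> \<alpha>"
    using pos \<open>0 < b\<close> \<open>0 < K\<close> by (simp_all add: field_simps)
  \<comment> \<open>The factor 2/3 cancels the upper constant 3/2 of the equivalence. The minimum
    takes the slower of the rates for velocities and distances.\<close>
  define c where "c = 2 / 3 * min \<gamma> (\<epsilon> * \<kappa>\<^sup>2)"
  have "0 < c"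
    using pos \<open>0 < \<epsilon>\<close> \<open>0 < \<kappa>\<close> by (simp add: c_def)
  define lo where "lo = min (\<alpha>\<^sup>2) 1"
  define hi where "hi = max (\<alpha>\<^sup>2) 1"
  have "0 < lo" "0 < hi" using pos by (auto simp: lo_def hi_def)
  let ?en = "\<lambda>z :: (real, 'n) vec \<times> (real, 'n) vec. \<alpha>\<^sup>2 * (norm (fst z))\<^sup>2 + (norm (snd z))\<^sup>2"
  have norm2: "(norm z)\<^sup>2 = (norm (fst z))\<^sup>2 + (norm (snd z))\<^sup>2" for z :: "(real, 'n) vec \<times> (real, 'n) vec"
    by (simp add: norm_prod_def)
  have lo: "lo * (norm z)\<^sup>2 \<le> ?en z" for z
    unfolding norm2 distrib_left
    by (intro add_mono mult_right_mono order_trans[OF mult_right_mono[of lo 1]]) (auto simp: lo_def)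
  have hi: "?en z \<le> hi * (norm z)\<^sup>2" for z
    unfolding norm2 distrib_left
    by (intro add_mono mult_right_mono order_trans[OF _ mult_right_mono[of 1 hi]]) (auto simp: hi_def)
  note equiv = lyapunov_equivalent[OF \<open>0 < \<alpha>\<close> \<open>0 < \<epsilon>\<close> eps(3) K]
  \<comment> \<open>The 3 is the ratio of the equivalence constants 3/2 and 1/2, and
    \<open>hi / lo\<close> compares the weighted energy with the squared norm. The estimate concerns
    squares, hence \<open>sqrt D\<close> and the rate \<open>c / 2\<close> below.\<close>
  define D where "D = 3 * hi / lo"
  have "0 < D" using \<open>0 < lo\<close> \<open>0 < hi\<close> by (simp add: D_def)
  have "norm (drift_flow \<alpha> \<beta> \<gamma> t \<cdot>\<^sub>E v) \<le> sqrt D * exp (- (c / 2) * t) * norm v"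
    if "0 \<le> t" and v: "(\<Sum>n\<in>UNIV. fst v $ n) = 0" for t and v :: "(real, 'n) vec \<times> (real, 'n) vec"
  proof -
    define z where "z t = drift_flow \<alpha> \<beta> \<gamma> t \<cdot>\<^sub>E v" for t
    have decay: "lyapunov \<alpha> \<epsilon> (z t) \<le> exp (- c * t) * lyapunov \<alpha> \<epsilon> (z 0)"
    proof (rule exp_decay_of_derivative[OF lyapunov_has_real_derivative[of \<alpha> \<epsilon> \<beta> \<gamma> v,
            folded z_def] _ \<open>0 \<le> t\<close>])
      fix s
      let ?q = "fst (z s)" and ?p = "snd (z s)"
      let ?a = "norm (backward_diff ?q)" and ?d = "norm (forward_diff ?p)"
      have "\<bar>backward_diff (forward_diff ?p) \<bullet> backward_diff ?q\<bar>
          \<le> norm (backward_diff (forward_diff ?p)) * ?a"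
        by (rule Cauchy_Schwarz_ineq2)
      also have "\<dots> \<le> K * ?d * ?a"
        by (intro mult_right_mono K) simp
      finally have x: "- (backward_diff (forward_diff ?p) \<bullet> backward_diff ?q) \<le> K * ?d * ?a"
        by linarith
      have y: "- (?p \<bullet> backward_diff ?q) \<le> norm ?p * ?a"
        using Cauchy_Schwarz_ineq2[of ?p "backward_diff ?q"] by linarith
      \<comment> \<open>The distances at time \<open>s\<close> still have sum \<open>0\<close>, so
        the Poincare inequality applies to them.\<close>
      have "(\<kappa> * norm ?q)\<^sup>2 \<le> ?a\<^sup>2"
        using \<kappa>[OF drift_flow_sum_fst[OF v]] \<open>0 < \<kappa>\<close>
        by (intro power_mono) (auto simp: z_def)
      then have q: "\<epsilon> * \<alpha>\<^sup>2 * (\<kappa> * norm ?q)\<^sup>2 \<le> \<epsilon> * \<alpha>\<^sup>2 * ?a\<^sup>2"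
        using \<open>0 < \<epsilon>\<close> by (intro mult_left_mono) auto
      have "c * lyapunov \<alpha> \<epsilon> (z s) \<le> c * (3 / 2 * ?en (z s))"
        using equiv(2)[of "z s"] \<open>0 < c\<close> by (intro mult_left_mono) auto
      also have "\<dots> = min \<gamma> (\<epsilon> * \<kappa>\<^sup>2) * (\<alpha>\<^sup>2 * (norm ?q)\<^sup>2) + min \<gamma> (\<epsilon> * \<kappa>\<^sup>2) * (norm ?p)\<^sup>2"
        by (simp add: c_def algebra_simps)
      also have "\<dots> \<le> \<epsilon> * \<kappa>\<^sup>2 * (\<alpha>\<^sup>2 * (norm ?q)\<^sup>2) + \<gamma> * (norm ?p)\<^sup>2"
        by (intro add_mono mult_right_mono) auto
      also have "\<dots> \<le> \<epsilon> * \<alpha>\<^sup>2 * ?a\<^sup>2 + \<gamma> * (norm ?p)\<^sup>2"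
        using q by (simp add: power_mult_distrib mult_ac)
      finally have "- \<gamma> * (norm ?p)\<^sup>2 - \<epsilon> * \<alpha>\<^sup>2 * ?a\<^sup>2 \<le> - c * lyapunov \<alpha> \<epsilon> (z s)"
        by simp
      with lyapunov_dissipation[OF pos \<open>0 < \<epsilon>\<close> eps(1)[unfolded b_def] eps(2) x y]
      show "(let q = ?q; p = ?p in
          - 2 * \<beta> * (forward_diff p \<bullet> forward_diff p) - 2 * \<gamma> * (p \<bullet> p)
          + 2 * \<epsilon> * (- \<alpha>\<^sup>2 * (backward_diff q \<bullet> backward_diff q)
         - \<beta> * (backward_diff (forward_diff p) \<bullet> backward_diff q)
         - \<gamma> * (p \<bullet> backward_diff q) + forward_diff p \<bullet> forward_diff p))
        \<le> - c * lyapunov \<alpha> \<epsilon> (z s)"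
        unfolding Let_def power2_norm_eq_inner by linarith
    qed
    have "lo * (norm (z t))\<^sup>2 \<le> 2 * (?en (z t) / 2)"
      using lo[of "z t"] by simp
    also have "\<dots> \<le> 2 * (exp (- c * t) * (3 / 2 * ?en (z 0)))"
      using equiv(1)[of "z t"] decay
        mult_left_mono[OF equiv(2)[of "z 0"] exp_ge_zero, of "- c * t"]
      by (intro mult_left_mono) linarith+
    also have "\<dots> \<le> 2 * (exp (- c * t) * (3 / 2 * (hi * (norm v)\<^sup>2)))"
      using hi[of "z 0"] by (intro mult_left_mono) (auto simp: z_def)
    finally have "(norm (z t))\<^sup>2 \<le> D * exp (- c * t) * (norm v)\<^sup>2"
      using \<open>0 < lo\<close> by (simp add: D_def field_simps)
    also have "\<dots> = (sqrt D * exp (- (c / 2) * t) * norm v)\<^sup>2"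
      using \<open>0 < D\<close> by (simp add: power_mult_distrib exp_double[symmetric])
    finally show ?thesis
      unfolding z_def by (rule power2_le_imp_le) (use \<open>0 < D\<close> in auto)
  qed
  then show ?thesis
    using \<open>0 < D\<close> \<open>0 < c\<close> by (intro exI[of _ "sqrt D"] conjI exI[of _ "c / 2"]) auto
qed

section \<open>Riemann sums and centred Gaussian laws\<close>

text \<open>On a cell of length \<open>h\<close> the integral differs from its right-endpoint value
  by at most \<open>h * e\<close>; the induction adds one cell at a time while \<open>g\<close> and
  the partition stay fixed.\<close>

lemma riemann_sum_error:
  fixes g :: "real \<Rightarrow> 'a::euclidean_space"
  assumes g: "continuous_on {0..real n * h} g" and "0 < h"
    and e: "\<And>i t. i < n \<Longrightarrow> real i * h \<le> t \<Longrightarrow> t \<le> real (Suc i) * h \<Longrightarrow>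
      norm (g t - g (real (Suc i) * h)) \<le> e"
    and "k \<le> n"
  shows "norm (integral {0..real k * h} g - (\<Sum>i=1..k. h *\<^sub>R g (real i * h))) \<le> real k * h * e"
  using \<open>k \<le> n\<close>
proof (induction k)
  case 0
  show ?case by simp
next
  case (Suc k)
  let ?a = "real k * h" and ?b = "real (Suc k) * h"
  have le: "0 \<le> ?a" "?a \<le> ?b" "?b \<le> real n * h"
    using \<open>0 < h\<close> Suc.prems by (auto intro!: mult_right_mono)
  have int: "g integrable_on {s..t}" if "0 \<le> s" "t \<le> ?b" for s t
    using that le by (intro integrable_continuous_real continuous_on_subset[OF g]) auto
  have split: "integral {0..?b} g = integral {0..?a} g + integral {?a..?b} g"
    using Henstock_Kurzweil_Integration.integral_combine[OF le(1,2) int] by simp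
  have "integral {?a..?b} g - h *\<^sub>R g ?b = integral {?a..?b} (\<lambda>t. g t - g ?b)"
    using le by (subst Henstock_Kurzweil_Integration.integral_diff[OF int])
      (auto simp: algebra_simps)
  moreover have "norm (integral {?a..?b} (\<lambda>t. g t - g ?b)) \<le> e * (?b - ?a)"
    using Suc.prems le
    by (intro integral_bound e continuous_intros continuous_on_subset[OF g]) auto
  ultimately have "norm (integral {?a..?b} g - h *\<^sub>R g ?b) \<le> h * e"
    by (simp add: algebra_simps)
  moreover have "norm (integral {0..?a} g - (\<Sum>i=1..k. h *\<^sub>R g (real i * h))) \<le> ?a * e"
    using Suc by simp
  ultimately have "norm ((integral {0..?a} g - (\<Sum>i=1..k. h *\<^sub>R g (real i * h)))
      + (integral {?a..?b} g - h *\<^sub>R g ?b)) \<le> ?a * e + h * e"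
    by (intro norm_triangle_mono)
  then show ?case
    unfolding split by (simp add: algebra_simps)
qed

lemma riemann_sum_tendsto_integral:
  fixes g :: "real \<Rightarrow> 'a::euclidean_space"
  assumes g: "continuous_on {0..T} g" and "0 < T"
  shows "(\<lambda>n. \<Sum>i=1..n. (T / real n) *\<^sub>R g (real i * (T / real n))) \<longlonglongrightarrow> integral {0..T} g"
proof (rule LIMSEQ_I)
  fix r :: real assume "0 < r"
  \<comment> \<open>Over the total length \<open>T\<close> this accumulates to
    \<open>r / 2\<close>.\<close>
  define e where "e = r / (2 * T)"
  have "0 < e" using \<open>0 < r\<close> \<open>0 < T\<close> by (simp add: e_def)
  from compact_uniformly_continuous[OF g] obtain d where "0 < d"
    and d: "\<And>s t. s \<in> {0..T} \<Longrightarrow> t \<in> {0..T} \<Longrightarrow> dist t s < d \<Longrightarrow> dist (g t) (g s) < e"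
    using \<open>0 < e\<close> unfolding uniformly_continuous_on_def by (metis compact_Icc)
  obtain N where N: "T / d < real N" using reals_Archimedean2 by blast
  have "norm ((\<Sum>i=1..n. (T / real n) *\<^sub>R g (real i * (T / real n))) - integral {0..T} g) < r"
    if "N \<le> n" for n
  proof -
    have n: "T / d < real n" using N that by linarith
    moreover have "0 < T / d" using \<open>0 < T\<close> \<open>0 < d\<close> by simp
    ultimately have "0 < n" by (metis of_nat_0_less_iff less_trans)
    define h where "h = T / real n"
    have h: "0 < h" "h < d" "real n * h = T"
      using \<open>0 < n\<close> \<open>0 < T\<close> \<open>0 < d\<close> n by (simp_all add: h_def field_simps)
    have "norm (integral {0..real n * h} g - (\<Sum>i=1..n. h *\<^sub>R g (real i * h))) \<le> real n * h * e"
    proof (rule riemann_sum_error[OF _ \<open>0 < h\<close> _ order_refl])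
      show "continuous_on {0..real n * h} g" using g h by simp
      fix i t assume *: "i < n" "real i * h \<le> t" "t \<le> real (Suc i) * h"
      have "real (Suc i) * h \<le> real n * h"
        using * h by (intro mult_right_mono) auto
      moreover have "0 \<le> real i * h" using h by simp
      then have "0 \<le> t" using *(2) by (rule order_trans)
      ultimately have "dist (g t) (g (real (Suc i) * h)) < e"
        using * h by (intro d) (auto simp: dist_real_def algebra_simps)
      then show "norm (g t - g (real (Suc i) * h)) \<le> e"
        by (simp add: dist_norm)
    qed
    also have "\<dots> < r" using h \<open>0 < r\<close> \<open>0 < T\<close> by (simp add: e_def)
    finally show ?thesis
      using h by (simp add: h_def norm_minus_commute)
  qed
  then show "\<exists>no. \<forall>n\<ge>no. norm ((\<Sum>i=1..n. (T / real n) *\<^sub>R g (real i * (T / real n)))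
      - integral {0..T} g) < r"
    by blast
qed

section \<open>Characteristic functions of centred normal laws\<close>

lemma (in prob_space) char_distr_eq:
  assumes [measurable]: "X \<in> borel_measurable M"
  shows "char (distr M borel X) \<theta> = (\<integral>\<omega>. iexp (\<theta> * X \<omega>) \<partial>M)"
  unfolding char_def by (rule integral_distr) measurable

lemma (in prob_space) char_normal:
  assumes X: "distributed M lborel X (normal_density 0 \<sigma>)" and "0 < \<sigma>"
  shows "char (distr M borel X) \<theta> = complex_of_real (exp (- (\<sigma>\<^sup>2 * \<theta>\<^sup>2 / 2)))"
proof -
  define Y where "Y \<omega> = X \<omega> / \<sigma>" for \<omega>
  have [measurable]: "X \<in> borel_measurable M"
    using distributed_measurable[OF X] by simp
  have [measurable]: "Y \<in> borel_measurable M"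
    unfolding Y_def[abs_def] by measurable
  have "distributed M lborel Y std_normal_density"
    using X normal_standard_normal_convert[OF \<open>0 < \<sigma>\<close>, of X 0] by (simp add: Y_def[abs_def])
  then have "distr M lborel Y = std_normal_distribution"
    by (rule distributed_distr_eq_density)
  then have Y: "distr M borel Y = std_normal_distribution"
    by (simp cong: distr_cong)
  have "char (distr M borel X) \<theta> = (\<integral>\<omega>. iexp ((\<theta> * \<sigma>) * Y \<omega>) \<partial>M)"
    using \<open>0 < \<sigma>\<close> by (simp add: char_distr_eq Y_def)
  also have "\<dots> = char (distr M borel Y) (\<theta> * \<sigma>)"
    by (simp add: char_distr_eq)
  finally show ?thesis
    by (simp add: Y char_std_normal_distribution power_mult_distrib mult.commute)
qed

lemma char_normal_distribution:
  assumes "0 \<le> s"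
  shows "char (normal_distribution 0 s) \<theta> = complex_of_real (exp (- (s\<^sup>2 * \<theta>\<^sup>2 / 2)))"
    and "real_distribution (normal_distribution 0 s)"
    and "integrable (normal_distribution 0 s) (\<lambda>x. x)"
    and "integral\<^sup>L (normal_distribution 0 s) (\<lambda>x. x) = 0"
proof -
  let ?N = "density lborel (\<lambda>x. ennreal (normal_density 0 s x))"
  consider "s = 0" | "0 < s" using assms by linarith
  then have "char (normal_distribution 0 s) \<theta> = complex_of_real (exp (- (s\<^sup>2 * \<theta>\<^sup>2 / 2))) \<and>
    real_distribution (normal_distribution 0 s) \<and> integrable (normal_distribution 0 s) (\<lambda>x. x) \<and>
    integral\<^sup>L (normal_distribution 0 s) (\<lambda>x. x) = 0"
  proof cases
    case 1
    have "integrable (return borel (0::real)) (\<lambda>x. x)"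
      by (rule integrableI_bounded) (auto simp: nn_integral_return)
    moreover have "real_distribution (return borel 0)"
      by (simp add: real_distribution_def real_distribution_axioms_def prob_space_return)
    moreover have "char (return borel 0) \<theta> = 1"
      by (simp add: char_def integral_return)
    moreover have "normal_distribution 0 s = return borel 0"
      using 1 by (simp add: normal_distribution_def)
    moreover have "integral\<^sup>L (return borel (0::real)) (\<lambda>x. x) = 0"
      by (simp add: integral_return)
    ultimately show ?thesis
      by (simp only: 1) simp
  next
    case 2
    then interpret N: prob_space ?N by (rule prob_space_normal_density)
    have "distributed ?N lborel (\<lambda>x. x) (normal_density 0 s)"
      by (auto simp: distributed_def distr_id2)
    from N.char_normal[OF this 2, of \<theta>]
    have "char ?N \<theta> = complex_of_real (exp (- (s\<^sup>2 * \<theta>\<^sup>2 / 2)))"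
      by (simp add: distr_id2)
    moreover have "real_distribution ?N"
      by (simp add: real_distribution_def real_distribution_axioms_def N.prob_space_axioms)
    moreover have "integrable ?N (\<lambda>x. x)"
      using integrable_normal_moment_nz_1[OF 2, of 0] by (subst integrable_density) auto
    moreover have "integral\<^sup>L ?N (\<lambda>x. x) = 0"
      using integral_normal_moment_nz_1[OF 2, of 0] by (subst integral_density) auto
    ultimately show ?thesis
      using 2 by (simp add: normal_distribution_def)
  qed
  then show "char (normal_distribution 0 s) \<theta> = complex_of_real (exp (- (s\<^sup>2 * \<theta>\<^sup>2 / 2)))"
    and "real_distribution (normal_distribution 0 s)"
    and "integrable (normal_distribution 0 s) (\<lambda>x. x)"
    and "integral\<^sup>L (normal_distribution 0 s) (\<lambda>x. x) = 0" by auto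
qed

text \<open>Gaussianity is recorded by the characteristic function with its variance
  \<open>V\<close>. In this form the degenerate case \<open>V = 0\<close> needs no separate
  treatment, and scaling, independent sums and limits become computations with exponentials.\<close>

definition centered_gaussian_char :: "'a measure \<Rightarrow> ('a \<Rightarrow> real) \<Rightarrow> real \<Rightarrow> bool"
  where "centered_gaussian_char M X V \<longleftrightarrow>
    0 \<le> V \<and> (\<forall>\<theta>. char (distr M borel X) \<theta> = complex_of_real (exp (- (V * \<theta>\<^sup>2 / 2))))"

lemma (in prob_space) centered_gaussian_char_imp_normal:
  assumes "X \<in> borel_measurable M" "centered_gaussian_char M X V"
  shows "distr M borel X = normal_distribution 0 (sqrt V)"
proof (rule Levy_uniqueness)
  show "char (distr M borel X) = char (normal_distribution 0 (sqrt V))"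
    using assms by (auto simp: centered_gaussian_char_def char_normal_distribution fun_eq_iff)
qed (use assms in \<open>auto simp: centered_gaussian_char_def
    intro: char_normal_distribution real_distribution_distr\<close>)

lemma (in prob_space) centered_gaussian_char_normal:
  assumes "distributed M lborel X (normal_density 0 \<sigma>)" "0 < \<sigma>"
  shows "centered_gaussian_char M X (\<sigma>\<^sup>2)"
  using char_normal[OF assms] by (simp add: centered_gaussian_char_def)

lemma (in prob_space) centered_gaussian_char_scale:
  assumes [measurable]: "X \<in> borel_measurable M" and X: "centered_gaussian_char M X V"
  shows "centered_gaussian_char M (\<lambda>\<omega>. a * X \<omega>) (a\<^sup>2 * V)"
proof -
  have "char (distr M borel (\<lambda>\<omega>. a * X \<omega>)) \<theta> = char (distr M borel X) (\<theta> * a)" for \<theta>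
    by (simp add: char_distr_eq mult_ac)
  with X show ?thesis
    by (simp add: centered_gaussian_char_def power_mult_distrib mult_ac)
qed

lemma (in prob_space) centered_gaussian_char_sum:
  assumes "indep_vars (\<lambda>_. borel) X I" "\<And>i. i \<in> I \<Longrightarrow> centered_gaussian_char M (X i) (V i)"
  shows "centered_gaussian_char M (\<lambda>\<omega>. \<Sum>i\<in>I. X i \<omega>) (\<Sum>i\<in>I. V i)"
proof (cases "finite I")
  case True
  then show ?thesis
  using assms(2) unfolding centered_gaussian_char_def char_distr_sum[OF assms(1)]
  by (auto simp: sum_nonneg exp_sum sum_distrib_right sum_divide_distrib
      simp flip: sum_negf of_real_prod)
\<comment> \<open>A sum over an infinite index set is \<open>0\<close> by convention, which has the
  degenerate law with variance \<open>0\<close>.\<close>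
next
  case False
  then show ?thesis
    by (simp add: centered_gaussian_char_def char_def integral_return)
qed

text \<open>Almost sure convergence implies convergence in distribution, by dominated convergence
  with a bound of \<open>f\<close> as majorant. The codomain is general so that the complex function
  \<open>iexp\<close> is covered as well as real test functions.\<close>

lemma (in prob_space) integral_bounded_continuous_LIMSEQ:
  fixes f :: "'b::euclidean_space \<Rightarrow> 'c::{banach, second_countable_topology}"
  assumes [measurable]: "\<And>n. X n \<in> borel_measurable M" "Y \<in> borel_measurable M"
    and lim: "AE \<omega> in M. (\<lambda>n. X n \<omega>) \<longlonglongrightarrow> Y \<omega>"
    and f: "continuous_on UNIV f" "bounded (range f)"
  shows "(\<lambda>n. \<integral>\<omega>. f (X n \<omega>) \<partial>M) \<longlonglongrightarrow> (\<integral>\<omega>. f (Y \<omega>) \<partial>M)"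
proof -
  have [measurable]: "f \<in> borel_measurable borel"
    using f(1) by (rule borel_measurable_continuous_onI)
  obtain C where C: "\<And>x. norm (f x) \<le> C"
    using f(2) by (auto simp: bounded_iff)
  show ?thesis
  proof (rule integral_dominated_convergence[where w="\<lambda>_. C"])
    show "AE \<omega> in M. (\<lambda>n. f (X n \<omega>)) \<longlonglongrightarrow> f (Y \<omega>)"
      using lim
    proof eventually_elim
      case (elim \<omega>)
      moreover have "isCont f (Y \<omega>)"
        using f(1) by (simp add: continuous_on_eq_continuous_at)
      ultimately show ?case by (rule isCont_tendsto_compose[rotated])
    qed
  qed (auto simp: C)
qed

text \<open>The characteristic functions converge pointwise, so it remains to show that the
  variances converge. A logarithm at one point \<open>x\<close> recovers them, provided that the
  limiting characteristic function does not vanish there; this is what prevents \<open>V n\<close>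
  from escaping to infinity.\<close>

lemma (in prob_space) centered_gaussian_char_LIMSEQ:
  assumes [measurable]: "\<And>n. X n \<in> borel_measurable M" "Y \<in> borel_measurable M"
    and lim: "AE \<omega> in M. (\<lambda>n. X n \<omega>) \<longlonglongrightarrow> Y \<omega>"
    and X: "\<And>n. centered_gaussian_char M (X n) (V n)"
  shows "\<exists>V'. centered_gaussian_char M Y V'"
proof -
  interpret Y: real_distribution "distr M borel Y"
    by (rule real_distribution_distr) fact
  let ?\<phi> = "char (distr M borel Y)"
  have "(\<lambda>n. char (distr M borel (X n)) \<theta>) \<longlonglongrightarrow> ?\<phi> \<theta>" for \<theta>
    unfolding char_distr_eq[OF assms(1)] char_distr_eq[OF assms(2)]
    by (rule integral_bounded_continuous_LIMSEQ[OF assms(1,2) lim])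
       (auto intro!: continuous_intros simp: bounded_iff)
  then have conv: "(\<lambda>n. complex_of_real (exp (- (V n * \<theta>\<^sup>2 / 2)))) \<longlonglongrightarrow> ?\<phi> \<theta>" for \<theta>
    using X by (simp add: centered_gaussian_char_def)
  have Vpos: "0 \<le> V n" for n using X by (simp add: centered_gaussian_char_def)
  \<comment> \<open>Continuity at \<open>0\<close>, where the characteristic function is
    \<open>1\<close>, supplies a nonzero point at which its real part is positive.\<close>
  have "(\<lambda>x. Re (?\<phi> x)) \<midarrow>0\<rightarrow> Re (?\<phi> 0)"
    using Y.isCont_char[of 0] by (intro tendsto_Re) (simp add: isCont_def)
  then have "(\<lambda>x. Re (?\<phi> x)) \<midarrow>0\<rightarrow> 1" by (simp add: Y.char_zero)
  then have "eventually (\<lambda>x. 0 < Re (?\<phi> x)) (at 0)"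
    by (rule order_tendstoD) simp
  then obtain d where "0 < d" and d: "\<And>x. x \<noteq> 0 \<Longrightarrow> dist x 0 < d \<Longrightarrow> 0 < Re (?\<phi> x)"
    by (auto simp: eventually_at)
  define x where "x = d / 2"
  have x: "x \<noteq> 0" "0 < Re (?\<phi> x)"
    using \<open>0 < d\<close> by (auto intro!: d simp: x_def)
  have "(\<lambda>n. exp (- (V n * x\<^sup>2 / 2))) \<longlonglongrightarrow> Re (?\<phi> x)"
    using tendsto_Re[OF conv[of x]] by simp
  from tendsto_ln[OF this] x have "(\<lambda>n. - (V n * x\<^sup>2 / 2)) \<longlonglongrightarrow> ln (Re (?\<phi> x))"
    by simp
  from tendsto_mult_left[OF this, of "- 2 / x\<^sup>2"]
  have "(\<lambda>n. - 2 / x\<^sup>2 * - (V n * x\<^sup>2 / 2)) \<longlonglongrightarrow> - 2 / x\<^sup>2 * ln (Re (?\<phi> x))" .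
  moreover have "- 2 / x\<^sup>2 * - (V n * x\<^sup>2 / 2) = V n" for n
    using x(1) by simp
  ultimately have V: "V \<longlonglongrightarrow> - 2 / x\<^sup>2 * ln (Re (?\<phi> x))" (is "_ \<longlonglongrightarrow> ?V")
    by (simp only:)
  have "0 \<le> ?V"
    by (rule LIMSEQ_le_const[OF V]) (simp add: Vpos)
  moreover have "?\<phi> \<theta> = complex_of_real (exp (- (?V * \<theta>\<^sup>2 / 2)))" for \<theta>
    by (rule LIMSEQ_unique[OF conv]) (intro tendsto_of_real tendsto_exp tendsto_minus
        tendsto_divide tendsto_mult V tendsto_const; simp)
  ultimately show ?thesis
    unfolding centered_gaussian_char_def by blast
qed

section \<open>Brownian increments and time reversal\<close>

lemma measurable_vec_lambda_PiM:
  "vec_lambda \<in> measurable (\<Pi>\<^sub>M n\<in>(UNIV :: 'n::finite set). (borel :: real measure)) (borel :: (real ^ 'n) measure)"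
  by (subst borel_measurable_euclidean_space) (auto simp: Basis_vec_def inner_axis)

lemma borel_measurable_vec_nth [measurable]:
  "(\<lambda>x :: real ^ 'n::finite. x $ n) \<in> borel_measurable borel"
  by (intro borel_measurable_continuous_onI continuous_intros)

lemma (in prob_space) centered_gaussian_char_cong_AE:
  assumes [measurable]: "X \<in> borel_measurable M" "Y \<in> borel_measurable M"
    and "AE \<omega> in M. X \<omega> = Y \<omega>"
  shows "centered_gaussian_char M X V \<longleftrightarrow> centered_gaussian_char M Y V"
proof -
  have "char (distr M borel X) \<theta> = char (distr M borel Y) \<theta>" for \<theta>
    unfolding char_distr_eq[OF assms(1)] char_distr_eq[OF assms(2)]
    using assms(3) by (intro integral_cong_AE) auto
  then show ?thesis by (simp add: centered_gaussian_char_def)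
qed

text \<open>Summation by parts: the increment \<open>d j\<close> enters every later grid value, and
  exchanging the sums collects its total coefficient.\<close>

lemma sum_nested_increments:
  fixes C :: "nat \<Rightarrow> 'a::real_vector \<Rightarrow> 'b::real_vector"
  assumes "\<And>i. linear (C i)"
  shows "(\<Sum>i=1..n. C i (\<Sum>j<i. d j)) = (\<Sum>j<n. \<Sum>i=Suc j..n. C i (d j))"
proof -
  have "(\<Sum>i=1..n. C i (\<Sum>j<i. d j)) = (\<Sum>i=1..n. \<Sum>j<i. C i (d j))"
    by (simp add: linear_sum[OF assms])
  also have "\<dots> = (\<Sum>j<n. \<Sum>i=Suc j..n. C i (d j))"
    by (simp add: sum.Sigma) (rule sum.reindex_bij_witness[of _ prod.swap prod.swap]; auto)
  finally show ?thesis .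
qed

text \<open>\<open>X\<close> is \<open>W\<close> with the exceptional null set removed, so that functionals of its paths are
  measurable without completing \<open>M\<close>.\<close>

locale brownian_version = prob_space M
  for M :: "'a measure" and W X :: "real \<Rightarrow> 'a \<Rightarrow> real ^ 'n::finite" +
  assumes brownian: "standard_brownian_motion M W"
    and version: "AE \<omega> in M. \<forall>t\<ge>0. X t \<omega> = W t \<omega>"
    and measurable_X [measurable]: "\<And>t. X t \<in> borel_measurable M"
    and X_0 [simp]: "\<And>\<omega>. X 0 \<omega> = 0"
    and continuous_X: "\<And>\<omega>. \<omega> \<in> space M \<Longrightarrow> continuous_on {0..} (\<lambda>t. X t \<omega>)"
begin

lemma W_measurable: "0 \<le> t \<Longrightarrow> W t \<in> borel_measurable M"
  using brownian by (simp add: standard_brownian_motion_def)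

lemma W_component_indep:
  "0 \<le> s \<Longrightarrow> s < t \<Longrightarrow> indep_vars (\<lambda>_. borel) (\<lambda>n \<omega>. (W t \<omega> - W s \<omega>) $ n) UNIV"
  using brownian by (simp add: standard_brownian_motion_def)

lemma W_component_normal:
  "0 \<le> s \<Longrightarrow> s < t \<Longrightarrow> distributed M lborel (\<lambda>\<omega>. (W t \<omega> - W s \<omega>) $ n) (normal_density 0 (sqrt (t - s)))"
  using brownian by (simp add: standard_brownian_motion_def)

text \<open>Taken from \<open>W\<close>, about which independence and normality are assumed, rather
  than from the modified path \<open>X\<close>.\<close>

definition increment :: "real \<Rightarrow> nat \<Rightarrow> 'a \<Rightarrow> real ^ 'n"
  where "increment h j \<omega> = W (real (Suc j) * h) \<omega> - W (real j * h) \<omega>"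

lemma increment_measurable:
  "0 < h \<Longrightarrow> increment h j \<in> borel_measurable M"
  unfolding increment_def[abs_def] by (intro borel_measurable_diff W_measurable) auto

lemma indep_vars_increment:
  assumes "0 < h"
  shows "indep_vars (\<lambda>_. borel) (increment h) {..<n}"
proof -
  have "\<forall>(k::nat) \<tau>. 0 \<le> \<tau> 0 \<and> (\<forall>i<k. \<tau> i < \<tau> (Suc i)) \<longrightarrow>
        indep_vars (\<lambda>_. borel) (\<lambda>i \<omega>. W (\<tau> (Suc i)) \<omega> - W (\<tau> i) \<omega>) {..<k}"
    using brownian by (simp add: standard_brownian_motion_def)
  from this[rule_format, of "\<lambda>i. real i * h" n] show ?thesis
    using assms by (simp add: increment_def[abs_def])
qed

text \<open>The right-hand side does not mention \<open>j\<close>: all increments of the grid have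
  one law, namely the product of their independent normal coordinates.\<close>

lemma increment_distr:
  assumes "0 < h"
  shows "distr M borel (increment h j) =
    distr (\<Pi>\<^sub>M n\<in>(UNIV :: 'n set). density lborel (normal_density 0 (sqrt h))) borel vec_lambda"
proof -
  let ?X = "\<lambda>n \<omega>. increment h j \<omega> $ n"
  let ?s = "real j * h" and ?t = "real (Suc j) * h"
  have st: "0 \<le> ?s" "?s < ?t" "?t - ?s = h"
    using assms by (auto simp: algebra_simps)
  have [measurable]: "increment h j \<in> borel_measurable M"
    by (rule increment_measurable[OF assms])
  have comp: "?X n \<in> borel_measurable M" for n
    by measurable
  have comp_distr: "distr M borel (?X n) = density lborel (normal_density 0 (sqrt h))" for n
  proof -
    have "distributed M lborel (?X n) (normal_density 0 (sqrt h))"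
      using W_component_normal[OF st(1,2), of n] unfolding increment_def st(3) .
    then have "distr M lborel (?X n) = density lborel (normal_density 0 (sqrt h))"
      by (rule distributed_distr_eq_density)
    then show ?thesis by (simp cong: distr_cong)
  qed
  have "indep_vars (\<lambda>_. borel) ?X UNIV"
    using W_component_indep[OF st(1,2)] by (simp add: increment_def)
  with indep_vars_iff_distr_eq_PiM[where I=UNIV and M'="\<lambda>_. borel" and X="?X"] comp
  have "distr M (\<Pi>\<^sub>M n\<in>UNIV. borel) (\<lambda>\<omega>. \<lambda>n\<in>UNIV. ?X n \<omega>) = (\<Pi>\<^sub>M n\<in>UNIV. distr M borel (?X n))"
    by simp
  also have "\<dots> = (\<Pi>\<^sub>M n\<in>(UNIV :: 'n set). density lborel (normal_density 0 (sqrt h)))"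
    by (simp only: comp_distr)
  finally have eq: "distr M (\<Pi>\<^sub>M n\<in>UNIV. borel) (\<lambda>\<omega>. \<lambda>n\<in>UNIV. ?X n \<omega>)
      = (\<Pi>\<^sub>M n\<in>(UNIV :: 'n set). density lborel (normal_density 0 (sqrt h)))" .
  have "distr (distr M (\<Pi>\<^sub>M n\<in>UNIV. borel) (\<lambda>\<omega>. \<lambda>n\<in>UNIV. ?X n \<omega>)) borel vec_lambda
      = distr M borel (vec_lambda \<circ> (\<lambda>\<omega>. \<lambda>n\<in>UNIV. ?X n \<omega>))"
    by (intro distr_distr measurable_vec_lambda_PiM) measurable
  also have "vec_lambda \<circ> (\<lambda>\<omega>. \<lambda>n\<in>UNIV. ?X n \<omega>) = increment h j"
    by (simp add: fun_eq_iff vec_eq_iff)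
  finally show ?thesis unfolding eq by (rule sym)
qed

text \<open>Independent and identically distributed increments have a power of one measure as joint
  law, and such a power is invariant under the permutation of indices sending \<open>j\<close> to
  \<open>n - Suc j\<close>.\<close>

lemma increments_reversal:
  fixes F :: "(nat \<Rightarrow> real ^ 'n) \<Rightarrow> 'c::{banach, second_countable_topology}"
  assumes "0 < h" and F: "F \<in> borel_measurable (\<Pi>\<^sub>M j\<in>{..<n}. borel)"
  shows "(\<integral>\<omega>. F (\<lambda>j\<in>{..<n}. increment h (n - Suc j) \<omega>) \<partial>M)
    = (\<integral>\<omega>. F (\<lambda>j\<in>{..<n}. increment h j \<omega>) \<partial>M)"
\<comment> \<open>The product description of independence is applied to a nonempty index set; for
  \<open>n = 0\<close> both sides coincide literally.\<close>
proof (cases "n = 0")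
  case False
  let ?P = "\<Pi>\<^sub>M j\<in>{..<n}. (borel :: (real ^ 'n) measure)"
  let ?r = "\<lambda>x. \<lambda>j\<in>{..<n}. x (n - Suc j)"
  let ?I = "\<lambda>\<omega>. \<lambda>j\<in>{..<n}. increment h j \<omega>"
  define \<mu> where "\<mu> = distr M borel (increment h 0)"
  have [measurable]: "increment h j \<in> borel_measurable M" for j
    by (rule increment_measurable[OF \<open>0 < h\<close>])
  have \<mu>: "distr M borel (increment h j) = \<mu>" for j
    by (simp add: \<mu>_def increment_distr[OF \<open>0 < h\<close>])
  have "prob_space \<mu>"
    unfolding \<mu>_def by (rule prob_space_distr) measurable
  have joint: "distr M ?P ?I = (\<Pi>\<^sub>M j\<in>{..<n}. \<mu>)"
    using indep_vars_iff_distr_eq_PiM[where I="{..<n}" and M'="\<lambda>_. borel" and X="increment h"]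
      indep_vars_increment[OF \<open>0 < h\<close>, of n] False
    by (auto simp: \<mu> lessThan_empty_iff)
  have sets: "sets (\<Pi>\<^sub>M j\<in>{..<n}. \<mu>) = sets ?P"
    by (intro sets_PiM_cong) (simp_all add: \<mu>_def)
  have r: "?r \<in> measurable ?P ?P"
    by (rule measurable_restrict) (auto intro: measurable_component_singleton)
  have "distr (\<Pi>\<^sub>M j\<in>{..<n}. \<mu>) (\<Pi>\<^sub>M j\<in>{..<n}. \<mu>) ?r = (\<Pi>\<^sub>M j\<in>{..<n}. \<mu>)"
    by (rule distr_PiM_reindex) (auto intro!: inj_onI \<open>prob_space \<mu>\<close>)
  then have rev: "distr (\<Pi>\<^sub>M j\<in>{..<n}. \<mu>) ?P ?r = (\<Pi>\<^sub>M j\<in>{..<n}. \<mu>)"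
    by (simp add: sets cong: distr_cong)
  have I: "?I \<in> measurable M ?P" by measurable
  have "(\<integral>\<omega>. F (\<lambda>j\<in>{..<n}. increment h (n - Suc j) \<omega>) \<partial>M) = (\<integral>\<omega>. F (?r (?I \<omega>)) \<partial>M)"
    by (intro Bochner_Integration.integral_cong refl arg_cong[where f=F]) auto
  also have "\<dots> = (\<integral>x. F (?r x) \<partial>distr M ?P ?I)"
    by (subst integral_distr[OF I measurable_compose[OF r F]]) simp
  also have "\<dots> = (\<integral>x. F x \<partial>distr (\<Pi>\<^sub>M j\<in>{..<n}. \<mu>) ?P ?r)"
    unfolding joint using r F
    by (subst integral_distr) (simp_all cong: measurable_cong_sets add: sets)
  also have "\<dots> = (\<integral>x. F x \<partial>distr M ?P ?I)"
    by (simp only: rev joint)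
  also have "\<dots> = (\<integral>\<omega>. F (?I \<omega>) \<partial>M)"
    by (rule integral_distr[OF I F])
  finally show ?thesis .
qed (simp add: restrict_def)

lemma increment_inner_gaussian:
  assumes "0 < h"
  shows "centered_gaussian_char M (\<lambda>\<omega>. a \<bullet> increment h j \<omega>) (\<Sum>n\<in>UNIV. (a $ n)\<^sup>2 * h)"
proof -
  let ?s = "real j * h" and ?t = "real (Suc j) * h"
  have st: "0 \<le> ?s" "?s < ?t" "?t - ?s = h"
    using assms by (auto simp: algebra_simps)
  have [measurable]: "increment h j \<in> borel_measurable M"
    by (rule increment_measurable[OF assms])
  have "indep_vars (\<lambda>_. borel) (\<lambda>n \<omega>. increment h j \<omega> $ n) UNIV"
    using W_component_indep[OF st(1,2)] by (simp add: increment_def)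
  then have "indep_vars (\<lambda>_. borel) (\<lambda>n \<omega>. a $ n * increment h j \<omega> $ n) UNIV"
    by (rule indep_vars_compose2) measurable
  moreover have "centered_gaussian_char M (\<lambda>\<omega>. a $ n * increment h j \<omega> $ n) ((a $ n)\<^sup>2 * h)" for n
  proof (rule centered_gaussian_char_scale)
    have "distributed M lborel (\<lambda>\<omega>. increment h j \<omega> $ n) (normal_density 0 (sqrt h))"
      using W_component_normal[OF st(1,2), of n] unfolding increment_def st(3) .
    from centered_gaussian_char_normal[OF this]
    show "centered_gaussian_char M (\<lambda>\<omega>. increment h j \<omega> $ n) h"
      using assms by simp
  qed measurable
  ultimately show ?thesis
    unfolding inner_vec_def inner_real_def by (rule centered_gaussian_char_sum)
qed

lemma increments_linear_gaussian:
  fixes K :: "nat \<Rightarrow> real ^ 'n \<Rightarrow> real"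
  assumes "0 < h" and K: "\<And>j. linear (K j)"
  shows "\<exists>V. centered_gaussian_char M (\<lambda>\<omega>. \<Sum>j<n. K j (increment h j \<omega>)) V"
proof -
  \<comment> \<open>A linear functional is the inner product with the image of \<open>1\<close>
    under its adjoint.\<close>
  define a where "a j = adjoint (K j) 1" for j
  have K_eq: "K j x = a j \<bullet> x" for j x
    using adjoint_works[OF K[of j], of x 1] by (simp add: a_def inner_commute)
  have [measurable]: "increment h j \<in> borel_measurable M" for j
    by (rule increment_measurable[OF \<open>0 < h\<close>])
  have "indep_vars (\<lambda>_. borel) (\<lambda>j \<omega>. a j \<bullet> increment h j \<omega>) {..<n}"
    by (rule indep_vars_compose2[OF indep_vars_increment[OF \<open>0 < h\<close>]]) measurable
  then have "centered_gaussian_char M (\<lambda>\<omega>. \<Sum>j<n. a j \<bullet> increment h j \<omega>)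
      (\<Sum>j<n. \<Sum>n\<in>UNIV. (a j $ n)\<^sup>2 * h)"
    by (rule centered_gaussian_char_sum) (rule increment_inner_gaussian[OF \<open>0 < h\<close>])
  then show ?thesis
    unfolding K_eq by blast
qed

lemma X_grid_eq_sum_increments:
  assumes "0 < h"
  shows "AE \<omega> in M. \<forall>i. X (real i * h) \<omega> = (\<Sum>j<i. increment h j \<omega>)"
  using version
proof eventually_elim
  case (elim \<omega>)
  show ?case
  proof
    fix i
    have "(\<Sum>j<i. increment h j \<omega>) = W (real i * h) \<omega> - W 0 \<omega>"
      unfolding increment_def by (subst sum_lessThan_telescope) simp
    moreover have "W 0 \<omega> = 0" using elim X_0[of \<omega>] by (metis order_refl)
    ultimately show "X (real i * h) \<omega> = (\<Sum>j<i. increment h j \<omega>)"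
      using elim assms by simp
  qed
qed

lemma X_grid_gaussian:
  fixes C :: "nat \<Rightarrow> real ^ 'n \<Rightarrow> real"
  assumes "0 < h" and C: "\<And>i. linear (C i)"
  shows "\<exists>V. centered_gaussian_char M (\<lambda>\<omega>. \<Sum>i=1..n. C i (X (real i * h) \<omega>)) V"
proof -
  have [measurable]: "C i \<in> borel_measurable borel" for i
    using C[of i] by (simp add: borel_measurable_continuous_onI linear_continuous_on linear_linear)
  have [measurable]: "increment h j \<in> borel_measurable M" for j
    by (rule increment_measurable[OF \<open>0 < h\<close>])
  have lin: "linear (\<lambda>x. \<Sum>i=Suc j..n. C i x)" for j
    using C by (intro linear_compose_sum) auto
  have [measurable]: "(\<lambda>x. \<Sum>i=Suc j..n. C i x) \<in> borel_measurable borel" for j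
    by measurable
  have "AE \<omega> in M. (\<Sum>i=1..n. C i (X (real i * h) \<omega>))
      = (\<Sum>j<n. \<Sum>i=Suc j..n. C i (increment h j \<omega>))"
    using X_grid_eq_sum_increments[OF \<open>0 < h\<close>]
    by eventually_elim (simp only: sum_nested_increments[OF C])
  from centered_gaussian_char_cong_AE[OF _ _ this] show ?thesis
    using increments_linear_gaussian[where K="\<lambda>j x. \<Sum>i=Suc j..n. C i x" and n=n, OF \<open>0 < h\<close> lin]
    by simp
qed

text \<open>The path read backwards from the final time has as its \<open>i\<close>-th grid value
  the sum of the last \<open>i\<close> increments in reversed order. Both sides are therefore the
  same function of the increments, evaluated at the reversed and at the original ones.\<close>

lemma X_grid_reversal:
  fixes C :: "nat \<Rightarrow> real ^ 'n \<Rightarrow> 'b::euclidean_space" and f :: "'b \<Rightarrow> real"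
  assumes "0 < h" and C: "\<And>i. linear (C i)" and [measurable]: "f \<in> borel_measurable borel"
  shows "(\<integral>\<omega>. f (\<Sum>i=1..n. C i (X (real n * h) \<omega> - X (real (n - i) * h) \<omega>)) \<partial>M)
    = (\<integral>\<omega>. f (\<Sum>i=1..n. C i (X (real i * h) \<omega>)) \<partial>M)"
proof -
  have [measurable]: "C i \<in> borel_measurable borel" for i
    using C[of i] by (simp add: borel_measurable_continuous_onI linear_continuous_on linear_linear)
  have [measurable]: "increment h j \<in> borel_measurable M" for j
    by (rule increment_measurable[OF \<open>0 < h\<close>])
  let ?F = "\<lambda>x. f (\<Sum>j<n. \<Sum>i=Suc j..n. C i (x j))"
  have F: "?F \<in> borel_measurable (\<Pi>\<^sub>M j\<in>{..<n}. borel)"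
    by measurable
  have tail: "(\<Sum>j<n. increment h j \<omega>) - (\<Sum>j<n - i. increment h j \<omega>)
      = (\<Sum>j<i. increment h (n - Suc j) \<omega>)" if "i \<le> n" for i \<omega>
  proof -
    have "(\<Sum>j<n. increment h j \<omega>) - (\<Sum>j<n - i. increment h j \<omega>) = (\<Sum>j\<in>{n - i..<n}. increment h j \<omega>)"
      using sum_diff_nat_ivl[of 0 "n - i" n "\<lambda>j. increment h j \<omega>"] by (simp add: atLeast0LessThan)
    also have "\<dots> = (\<Sum>j<i. increment h (n - Suc j) \<omega>)"
      using that by (intro sum.reindex_bij_witness[of _ "\<lambda>j. n - Suc j" "\<lambda>j. n - Suc j"]) auto
    finally show ?thesis .
  qed
  have "(\<integral>\<omega>. f (\<Sum>i=1..n. C i (X (real n * h) \<omega> - X (real (n - i) * h) \<omega>)) \<partial>M)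
      = (\<integral>\<omega>. f (\<Sum>j<n. \<Sum>i=Suc j..n. C i (increment h (n - Suc j) \<omega>)) \<partial>M)"
  proof (rule integral_cong_AE)
    show "AE \<omega> in M. f (\<Sum>i=1..n. C i (X (real n * h) \<omega> - X (real (n - i) * h) \<omega>))
        = f (\<Sum>j<n. \<Sum>i=Suc j..n. C i (increment h (n - Suc j) \<omega>))"
      using X_grid_eq_sum_increments[OF \<open>0 < h\<close>]
    proof eventually_elim
      case (elim \<omega>)
      have "(\<Sum>i=1..n. C i (X (real n * h) \<omega> - X (real (n - i) * h) \<omega>))
          = (\<Sum>i=1..n. C i (\<Sum>j<i. increment h (n - Suc j) \<omega>))"
        using elim by (intro sum.cong refl) (simp add: tail del: of_nat_diff)
      also have "\<dots> = (\<Sum>j<n. \<Sum>i=Suc j..n. C i (increment h (n - Suc j) \<omega>))"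
        by (rule sum_nested_increments[OF C])
      finally show ?case by simp
    qed
  qed measurable
  also have "\<dots> = (\<integral>\<omega>. f (\<Sum>j<n. \<Sum>i=Suc j..n. C i (increment h j \<omega>)) \<partial>M)"
    using increments_reversal[OF \<open>0 < h\<close> F] by simp
  also have "\<dots> = (\<integral>\<omega>. f (\<Sum>i=1..n. C i (X (real i * h) \<omega>)) \<partial>M)"
  proof (rule integral_cong_AE)
    show "AE \<omega> in M. f (\<Sum>j<n. \<Sum>i=Suc j..n. C i (increment h j \<omega>)) = f (\<Sum>i=1..n. C i (X (real i * h) \<omega>))"
      using X_grid_eq_sum_increments[OF \<open>0 < h\<close>]
      by eventually_elim (simp only: sum_nested_increments[OF C])
  qed measurable
  finally show ?thesis .
qed

text \<open>The crude inequality \<open>\<bar>y\<bar> \<le> 1 + y\<^sup>2\<close> reduces the first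
  moment of each coordinate to its variance. Linear growth in \<open>s\<close> is good enough,
  because the moment is only ever multiplied by a decaying exponential.\<close>

lemma X_norm_moment:
  assumes "0 \<le> s"
  shows "integrable M (\<lambda>\<omega>. norm (X s \<omega>))"
    and "expectation (\<lambda>\<omega>. norm (X s \<omega>)) \<le> real CARD('n) * (1 + s)"
proof -
  have comp: "integrable M (\<lambda>\<omega>. \<bar>X s \<omega> $ n\<bar>) \<and> expectation (\<lambda>\<omega>. \<bar>X s \<omega> $ n\<bar>) \<le> 1 + s" for n
  proof (cases "s = 0")
    case False
    with assms have "0 < s" by simp
    let ?Y = "\<lambda>\<omega>. (W s \<omega> - W 0 \<omega>) $ n"
    have Y: "distributed M lborel ?Y (normal_density 0 (sqrt s))"
      using W_component_normal[of 0 s n] \<open>0 < s\<close> by simp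
    have [measurable]: "?Y \<in> borel_measurable M"
      using distributed_measurable[OF Y] by simp
    have eq: "AE \<omega> in M. \<bar>X s \<omega> $ n\<bar> = \<bar>?Y \<omega>\<bar>"
      using version
    proof eventually_elim
      case (elim \<omega>)
      have "W 0 \<omega> = 0" using elim X_0[of \<omega>] by (metis order_refl)
      then show ?case using elim assms by simp
    qed
    have "integrable lborel (\<lambda>x. normal_density 0 (sqrt s) x * x\<^sup>2)"
      using integrable_normal_moment[of "sqrt s" 0 2] \<open>0 < s\<close> by simp
    then have int2: "integrable M (\<lambda>\<omega>. (?Y \<omega>)\<^sup>2)"
      using distributed_integrable[OF Y, of "\<lambda>x. x\<^sup>2"] by simp
    have "integrable lborel (\<lambda>x. normal_density 0 (sqrt s) x * \<bar>x\<bar>)"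
      using integrable_normal_moment_abs[of "sqrt s" 0 1] \<open>0 < s\<close> by simp
    then have int1: "integrable M (\<lambda>\<omega>. \<bar>?Y \<omega>\<bar>)"
      using distributed_integrable[OF Y, of abs] by simp
    have "expectation (\<lambda>\<omega>. (?Y \<omega>)\<^sup>2) = s"
      using normal_distributed_variance[OF _ Y] normal_distributed_expectation[OF _ Y] \<open>0 < s\<close>
      by simp
    have "expectation (\<lambda>\<omega>. \<bar>?Y \<omega>\<bar>) \<le> expectation (\<lambda>\<omega>. 1 + (?Y \<omega>)\<^sup>2)"
    proof (intro integral_mono int1 Bochner_Integration.integrable_add int2)
      fix \<omega>
      have "\<bar>y\<bar> \<le> 1 + y\<^sup>2" for y :: real
        using zero_le_power2[of "\<bar>y\<bar> - 1"] zero_le_power2[of y] unfolding power2_diff by simp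
      then show "\<bar>?Y \<omega>\<bar> \<le> 1 + (?Y \<omega>)\<^sup>2" .
    qed simp
    also have "\<dots> = 1 + s"
      using int2 \<open>expectation (\<lambda>\<omega>. (?Y \<omega>)\<^sup>2) = s\<close> by (simp add: prob_space)
    finally have "expectation (\<lambda>\<omega>. \<bar>?Y \<omega>\<bar>) \<le> 1 + s" .
    moreover have "integrable M (\<lambda>\<omega>. \<bar>X s \<omega> $ n\<bar>) \<longleftrightarrow> integrable M (\<lambda>\<omega>. \<bar>?Y \<omega>\<bar>)"
      by (rule integrable_cong_AE[OF _ _ eq]) measurable
    moreover have "expectation (\<lambda>\<omega>. \<bar>X s \<omega> $ n\<bar>) = expectation (\<lambda>\<omega>. \<bar>?Y \<omega>\<bar>)"
      by (rule integral_cong_AE[OF _ _ eq]) measurable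
    ultimately show ?thesis using int1 by simp
  qed simp
  have sum: "integrable M (\<lambda>\<omega>. \<Sum>n\<in>UNIV. \<bar>X s \<omega> $ n\<bar>)"
    using comp by (intro Bochner_Integration.integrable_sum) auto
  show int: "integrable M (\<lambda>\<omega>. norm (X s \<omega>))"
    by (rule Bochner_Integration.integrable_bound[OF sum])
       (auto intro!: AE_I2 order_trans[OF norm_le_l1_cart])
  have "expectation (\<lambda>\<omega>. norm (X s \<omega>)) \<le> expectation (\<lambda>\<omega>. \<Sum>n\<in>UNIV. \<bar>X s \<omega> $ n\<bar>)"
    by (intro integral_mono int sum norm_le_l1_cart)
  also have "\<dots> = (\<Sum>n\<in>UNIV. expectation (\<lambda>\<omega>. \<bar>X s \<omega> $ n\<bar>))"
    using comp by (intro Bochner_Integration.integral_sum) auto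
  also have "\<dots> \<le> (\<Sum>n\<in>(UNIV :: 'n set). 1 + s)"
    using comp by (intro sum_mono) auto
  finally show "expectation (\<lambda>\<omega>. norm (X s \<omega>)) \<le> real CARD('n) * (1 + s)"
    by simp
qed

end

lemma brownian_version_exists:
  fixes W :: "real \<Rightarrow> 'a \<Rightarrow> real ^ 'n::finite"
  assumes W: "standard_brownian_motion M W"
  obtains X where "brownian_version M W X"
proof -
  interpret prob_space M using W by (simp add: standard_brownian_motion_def)
  have "AE \<omega> in M. W 0 \<omega> = 0 \<and> continuous_on {0..} (\<lambda>t. W t \<omega>)"
    using W by (auto simp: standard_brownian_motion_def)
  then obtain N where N: "N \<in> null_sets M"
    "\<And>\<omega>. \<omega> \<in> space M - N \<Longrightarrow> W 0 \<omega> = 0 \<and> continuous_on {0..} (\<lambda>t. W t \<omega>)"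
    by (rule AE_E3) blast
  \<comment> \<open>\<open>max 0 t\<close> avoids negative times, at which nothing is known about
    \<open>W\<close>.\<close>
  define X where "X t \<omega> = (if \<omega> \<in> space M - N then W (max 0 t) \<omega> else 0)" for t \<omega>
  have good: "W 0 \<omega> = 0" "continuous_on {0..} (\<lambda>t. W t \<omega>)" if "\<omega> \<in> space M - N" for \<omega>
    using N(2) that by auto
  have "brownian_version M W X"
  proof
    show "AE \<omega> in M. \<forall>t\<ge>0. X t \<omega> = W t \<omega>"
      using AE_not_in[OF N(1)] AE_space by eventually_elim (simp add: X_def)
    show "X t \<in> borel_measurable M" for t
      unfolding X_def[abs_def] using N(1) W
      by (intro measurable_If_set) (auto simp: standard_brownian_motion_def null_sets_def)
    show "X 0 \<omega> = 0" for \<omega>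
      using good(1) by (auto simp: X_def)
    show "continuous_on {0..} (\<lambda>t. X t \<omega>)" for \<omega>
    proof (cases "\<omega> \<in> space M - N")
      case True
      then show ?thesis
        using good(2)[OF True] by (rule_tac continuous_on_eq) (auto simp: X_def)
    next
      case False
      then have "X t \<omega> = 0" for t by (simp add: X_def del: DiffI Diff_iff)
      then show ?thesis by simp
    qed
  qed (use W in auto)
  then show ?thesis by (rule that)
qed

section \<open>Stochastic integrals as functionals of continuous paths\<close>

lemma integral_reflect_Icc:
  fixes g :: "real \<Rightarrow> 'a::euclidean_space"
  assumes g: "continuous_on {0..T} g" and "0 \<le> T"
  shows "integral {0..T} (\<lambda>s. g (T - s)) = integral {0..T} g"
proof -
  let ?H = "\<lambda>s. integral {0..s} g"
  have img: "(\<lambda>s. T - s) ` {0..T} = {0..T}"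
  proof
    show "{0..T} \<subseteq> (\<lambda>s. T - s) ` {0..T}"
      by (auto intro!: image_eqI[where x="T - x" for x])
  qed auto
  have "((\<lambda>s. - ?H (T - s)) has_vector_derivative g (T - s)) (at s within {0..T})"
    if s: "s \<in> {0..T}" for s
  proof -
    have "((\<lambda>s. T - s) has_vector_derivative - 1) (at s within {0..T})"
      by (auto intro!: derivative_eq_intros)
    moreover have "(?H has_vector_derivative g (T - s)) (at (T - s) within (\<lambda>s. T - s) ` {0..T})"
      unfolding img using s by (intro integral_has_vector_derivative g) auto
    ultimately have "(?H \<circ> (\<lambda>s. T - s) has_vector_derivative - 1 *\<^sub>R g (T - s)) (at s within {0..T})"
      by (rule vector_diff_chain_within)
    from has_vector_derivative_minus[OF this] show ?thesis by (simp add: o_def)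
  qed
  from fundamental_theorem_of_calculus[OF \<open>0 \<le> T\<close> this]
  show ?thesis by (simp add: integral_unique)
qed

text \<open>This is the Stieltjes integral of \<open>exp (s B) g\<close> against \<open>w\<close> over \<open>[0, T]\<close> for \<open>w 0 = 0\<close>,
  integrated by parts.\<close>

definition path_functional ::
  "'b::euclidean_space endo \<Rightarrow> ('w \<Rightarrow> 'b) \<Rightarrow> real \<Rightarrow> (real \<Rightarrow> 'w) \<Rightarrow> 'b"
  where "path_functional B g T w =
    flow B T \<cdot>\<^sub>E g (w T) - integral {0..T} (\<lambda>s. (flow B s * B) \<cdot>\<^sub>E g (w s))"

text \<open>Weight of the \<open>i\<close>-th grid value in the Riemann sum for
  \<open>path_functional\<close>. The boundary term is put into the last weight, so that the
  approximation is a single linear combination of grid values.\<close>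

definition path_coeff ::
  "'b::euclidean_space endo \<Rightarrow> ('w \<Rightarrow> 'b) \<Rightarrow> real \<Rightarrow> nat \<Rightarrow> nat \<Rightarrow> 'w \<Rightarrow> 'b"
  where "path_coeff B g T n i x = (if i = n then flow B T \<cdot>\<^sub>E g x else 0)
    - (T / real n) *\<^sub>R ((flow B (real i * (T / real n)) * B) \<cdot>\<^sub>E g x)"

lemma linear_path_coeff:
  assumes "bounded_linear g"
  shows "linear (path_coeff B g T n i)"
proof -
  interpret bounded_linear g by fact
  show ?thesis
    by (intro linearI)
      (simp_all add: path_coeff_def add scaleR endo.add_right endo.scaleR_right algebra_simps)
qed

lemma continuous_on_kernel:
  fixes B :: "'b::euclidean_space endo"
  assumes "bounded_linear g" and w: "continuous_on S w"
  shows "continuous_on S (\<lambda>s. (flow B s * B) \<cdot>\<^sub>E g (w s))"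
  by (intro bounded_bilinear.continuous_on[OF bounded_bilinear_endo_apply] continuous_intros
      bounded_linear.continuous_on[OF assms])

lemma path_functional_LIMSEQ:
  assumes g: "bounded_linear g" and w: "continuous_on {0..T} w" and "0 < T"
  shows "(\<lambda>n. \<Sum>i=1..n. path_coeff B g T n i (w (real i * (T / real n)))) \<longlonglongrightarrow> path_functional B g T w"
proof -
  have "(\<lambda>n. flow B T \<cdot>\<^sub>E g (w T) - (\<Sum>i=1..n. (T / real n) *\<^sub>R
      ((flow B (real i * (T / real n)) * B) \<cdot>\<^sub>E g (w (real i * (T / real n)))))) \<longlonglongrightarrow> path_functional B g T w"
    unfolding path_functional_def
    by (intro tendsto_diff tendsto_const
        riemann_sum_tendsto_integral[OF continuous_on_kernel[OF g w] \<open>0 < T\<close>])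
  moreover have "(\<Sum>i=1..n. path_coeff B g T n i (w (real i * (T / real n)))) =
      flow B T \<cdot>\<^sub>E g (w T) - (\<Sum>i=1..n. (T / real n) *\<^sub>R
      ((flow B (real i * (T / real n)) * B) \<cdot>\<^sub>E g (w (real i * (T / real n)))))"
    (is "?lhs n = ?rhs n") if "1 \<le> n" for n
  proof -
    have "(\<Sum>i=1..n. if i = n then flow B T \<cdot>\<^sub>E g (w (real i * (T / real n))) else 0)
        = flow B T \<cdot>\<^sub>E g (w T)"
      using that by (simp add: sum.delta)
    then show ?thesis
      unfolding path_coeff_def sum_subtractf by simp
  qed
  \<comment> \<open>For \<open>n = 0\<close> the sum of weights is empty and misses the boundary
    term.\<close>
  then have "\<forall>\<^sub>F n in sequentially. ?rhs n = ?lhs n"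
    by (intro eventually_sequentiallyI[of 1]) (rule sym)
  ultimately show ?thesis
    by (rule Lim_transform_eventually)
qed

text \<open>The right-hand side is the noise term of the variation of constants formula.\<close>

lemma path_functional_reversed:
  fixes w :: "real \<Rightarrow> 'w::real_normed_vector"
  assumes g: "bounded_linear g" and w: "continuous_on {0..T} w" and "0 \<le> T" and "w 0 = 0"
  shows "path_functional B g T (\<lambda>s. w T - w (T - s)) =
    g (w T) + integral {0..T} (\<lambda>s. flow B (T - s) \<cdot>\<^sub>E B \<cdot>\<^sub>E g (w s))"
proof -
  interpret g: bounded_linear g by fact
  let ?k = "\<lambda>s x. (flow B s * B) \<cdot>\<^sub>E g x"
  have "((\<lambda>s. flow B s \<cdot>\<^sub>E g (w T)) has_vector_derivative ?k s (w T)) (at s within {0..T})" for s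
    by (rule bounded_linear.has_vector_derivative[OF endo.bounded_linear_left flow_has_vector_derivative])
  \<comment> \<open>The contribution of the constant \<open>w T\<close> integrates exactly; it
    cancels the boundary term of \<open>path_functional\<close> and leaves
    \<open>g (w T)\<close>.\<close>
  from fundamental_theorem_of_calculus[OF \<open>0 \<le> T\<close> this]
  have 1: "integral {0..T} (\<lambda>s. ?k s (w T)) = flow B T \<cdot>\<^sub>E g (w T) - g (w T)"
    by (simp add: integral_unique)
  have "continuous_on {0..T} (\<lambda>s. w (T - s))"
    by (intro continuous_on_compose2[OF w] continuous_intros) auto
  then have cont: "continuous_on {0..T} (\<lambda>s. ?k s (w (T - s)))"
    by (rule continuous_on_kernel[OF g])
  have "integral {0..T} (\<lambda>s. ?k s (w (T - s))) = integral {0..T} (\<lambda>s. ?k (T - s) (w (T - (T - s))))"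
    using integral_reflect_Icc[OF cont \<open>0 \<le> T\<close>] by (rule sym)
  then have 2: "integral {0..T} (\<lambda>s. ?k s (w (T - s)))
      = integral {0..T} (\<lambda>s. flow B (T - s) \<cdot>\<^sub>E B \<cdot>\<^sub>E g (w s))"
    by (simp add: endo_apply_times)
  have "integral {0..T} (\<lambda>s. ?k s (w T - w (T - s)))
      = integral {0..T} (\<lambda>s. ?k s (w T) - ?k s (w (T - s)))"
    by (simp add: g.diff endo.diff_right)
  also have "\<dots> = integral {0..T} (\<lambda>s. ?k s (w T)) - integral {0..T} (\<lambda>s. ?k s (w (T - s)))"
    by (intro Henstock_Kurzweil_Integration.integral_diff integrable_continuous_real cont
        continuous_on_kernel[OF g] continuous_intros)
  finally show ?thesis
    unfolding path_functional_def by (simp add: 1 2 \<open>w 0 = 0\<close>)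
qed

text \<open>If convergence failed, there would be a bad time beyond every \<open>n\<close>, and
  choosing one for each \<open>n\<close> gives a violating sequence.\<close>

lemma tendsto_at_top_if_sequences:
  fixes F :: "real \<Rightarrow> 'b::metric_space"
  assumes seq: "\<And>t. (\<And>n. real n \<le> t n) \<Longrightarrow> (\<lambda>n. F (t n)) \<longlonglongrightarrow> L"
  shows "(F \<longlongrightarrow> L) at_top"
proof (rule ccontr)
  assume "\<not> (F \<longlongrightarrow> L) at_top"
  then obtain e where "0 < e" and e: "\<And>n::nat. \<exists>t\<ge>real n. e \<le> dist (F t) L"
    unfolding tendsto_iff eventually_at_top_linorder by (meson not_less)
  then obtain t where t: "\<And>n. real n \<le> t n" "\<And>n. e \<le> dist (F (t n)) L"
    by metis
  have "eventually (\<lambda>n. dist (F (t n)) L < e) sequentially"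
    using tendstoD[OF seq[of t, OF t(1)] \<open>0 < e\<close>] .
  then obtain n where "dist (F (t n)) L < e"
    by (auto simp: eventually_sequentially)
  with t(2)[of n] show False by simp
qed

text \<open>Summable first moments make the sum of the norms integrable, hence almost surely finite,
  so its terms tend to \<open>0\<close>.\<close>

lemma (in prob_space) AE_LIMSEQ_0_if_geometric_moments:
  fixes Y :: "nat \<Rightarrow> 'a \<Rightarrow> 'b::euclidean_space"
  assumes [measurable]: "\<And>n. Y n \<in> borel_measurable M"
    and int: "\<And>n. (\<integral>\<^sup>+\<omega>. ennreal (norm (Y n \<omega>)) \<partial>M) \<le> ennreal (K * r ^ n)"
    and "0 \<le> K" "0 \<le> r" "r < 1"
  shows "AE \<omega> in M. (\<lambda>n. Y n \<omega>) \<longlonglongrightarrow> 0"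
proof -
  have "summable (\<lambda>n. K * r ^ n)"
    using assms by (intro summable_mult summable_geometric) auto
  then have "(\<Sum>n. ennreal (K * r ^ n)) \<noteq> \<infinity>"
    using assms by (subst suminf_ennreal2) auto
  moreover have "(\<integral>\<^sup>+\<omega>. (\<Sum>n. ennreal (norm (Y n \<omega>))) \<partial>M) \<le> (\<Sum>n. ennreal (K * r ^ n))"
    by (subst nn_integral_suminf) (auto intro!: suminf_le int)
  ultimately have "(\<integral>\<^sup>+\<omega>. (\<Sum>n. ennreal (norm (Y n \<omega>))) \<partial>M) \<noteq> \<infinity>"
    by (metis infinity_ennreal_def neq_top_trans)
  then have "AE \<omega> in M. (\<Sum>n. ennreal (norm (Y n \<omega>))) \<noteq> \<infinity>"
    by (intro nn_integral_PInf_AE) measurable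
  then show ?thesis
  proof eventually_elim
    case (elim \<omega>)
    then have "summable (\<lambda>n. norm (Y n \<omega>))"
      by (intro summable_suminf_not_top) auto
    then show ?case
      by (rule tendsto_norm_zero_cancel[OF summable_LIMSEQ_zero])
  qed
qed

text \<open>The bound \<open>1 + y \<le> exp y\<close> at \<open>y = c / 2 * t\<close> trades half
  of the decay rate for the linear growth of Brownian moments.\<close>

lemma exp_linear_le_exp_half:
  fixes c t :: real
  assumes "0 < c" "0 \<le> t"
  shows "exp (- c * t) * (1 + t) \<le> (1 + 2 / c) * exp (- (c / 2) * t)"
proof -
  have "1 + (c / 2) * t \<le> exp ((c / 2) * t)"
    by (rule exp_ge_add_one_self)
  then have "t \<le> (2 / c) * exp ((c / 2) * t)"
    using assms by (simp add: field_simps)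
  moreover have "1 \<le> exp ((c / 2) * t)"
    using assms by simp
  ultimately have "1 + t \<le> (1 + 2 / c) * exp ((c / 2) * t)"
    unfolding distrib_right by linarith
  then have "exp (- c * t) * (1 + t) \<le> exp (- c * t) * ((1 + 2 / c) * exp ((c / 2) * t))"
    by (intro mult_left_mono) auto
  also have "\<dots> = (1 + 2 / c) * exp (- c * t + (c / 2) * t)"
    unfolding exp_add by simp
  also have "- c * t + (c / 2) * t = - (c / 2) * t"
    by (simp add: field_simps)
  finally show ?thesis .
qed

section \<open>The limit of the noise\<close>

text \<open>Decay is assumed only on the vectors \<open>g x\<close> and their images under
  \<open>B\<close>, the only directions in which noise is propagated. Decay on the whole space would
  exclude the agent system.\<close>

locale stable_noise = brownian_version M W X
  for M :: "'a measure" and W X :: "real \<Rightarrow> 'a \<Rightarrow> real ^ 'n::finite" +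
  fixes B :: "'b::euclidean_space endo" and g :: "real ^ 'n \<Rightarrow> 'b" and C c :: real
  assumes g: "bounded_linear g" and c: "0 < c"
    and flow_decay: "\<And>t x. 0 \<le> t \<Longrightarrow> norm (flow B t \<cdot>\<^sub>E g x) \<le> C * exp (- c * t) * norm x"
    and kernel_decay: "\<And>t x. 0 \<le> t \<Longrightarrow> norm ((flow B t * B) \<cdot>\<^sub>E g x) \<le> C * exp (- c * t) * norm x"
begin

definition noise :: "real \<Rightarrow> 'a \<Rightarrow> 'b"
  where "noise T \<omega> = path_functional B g T (\<lambda>s. X s \<omega>)"

text \<open>The integrand of \<open>path_functional\<close>, extended by \<open>0\<close> to the
  whole line so that the improper integral becomes a Lebesgue integral.\<close>

definition kernel :: "'a \<Rightarrow> real \<Rightarrow> 'b"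
  where "kernel \<omega> s = indicator {0..} s *\<^sub>R ((flow B s * B) \<cdot>\<^sub>E g (X (max 0 s) \<omega>))"

text \<open>What remains of \<open>path_functional\<close> as time grows and its boundary term
  vanishes. On the null set of paths with a nonintegrable kernel the integral has its default value
  \<open>0\<close>.\<close>

definition limit_noise :: "'a \<Rightarrow> 'b"
  where "limit_noise \<omega> = - (\<integral>s. kernel \<omega> s \<partial>lborel)"

lemma C_nonneg: "0 \<le> C"
proof -
  have "0 \<le> C * exp (- c * 0) * norm (1 :: real ^ 'n)"
    by (rule order_trans[OF norm_ge_zero flow_decay]) simp
  then show ?thesis by (simp add: zero_le_mult_iff)
qed

lemma continuous_path: "\<omega> \<in> space M \<Longrightarrow> continuous_on {0..T} (\<lambda>s. X s \<omega>)"
  by (rule continuous_on_subset[OF continuous_X]) auto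

lemma measurable_g [measurable]: "g \<in> borel_measurable borel"
  using g by (simp add: borel_measurable_continuous_onI linear_continuous_on)

lemma measurable_endo_apply [measurable]: "(\<lambda>x. F \<cdot>\<^sub>E x) \<in> borel_measurable borel"
  for F :: "'b endo"
  by (intro borel_measurable_continuous_onI linear_continuous_on endo.bounded_linear_right)

lemma measurable_path_coeff [measurable]: "path_coeff B g T n i \<in> borel_measurable borel"
  using linear_path_coeff[OF g]
  by (simp add: borel_measurable_continuous_onI linear_continuous_on linear_linear)

lemma noise_LIMSEQ:
  "\<omega> \<in> space M \<Longrightarrow> 0 < T \<Longrightarrow>
    (\<lambda>n. \<Sum>i=1..n. path_coeff B g T n i (X (real i * (T / real n)) \<omega>)) \<longlonglongrightarrow> noise T \<omega>"
  unfolding noise_def by (rule path_functional_LIMSEQ[OF g continuous_path])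

lemma measurable_noise [measurable]: "noise T \<in> borel_measurable M" if "0 < T"
  by (rule borel_measurable_LIMSEQ_metric[OF _ noise_LIMSEQ[OF _ that]]) measurable

lemma noise_gaussian:
  assumes "0 < T"
  shows "\<exists>V. centered_gaussian_char M (\<lambda>\<omega>. noise T \<omega> \<bullet> v) V"
proof -
  let ?S = "\<lambda>n \<omega>. (\<Sum>i=1..n. path_coeff B g T n i (X (real i * (T / real n)) \<omega>)) \<bullet> v"
  \<comment> \<open>\<open>Suc n\<close> keeps the mesh positive, as the grid lemmas demand.\<close>
  have "\<exists>V. centered_gaussian_char M (?S (Suc n)) V" for n
  proof -
    have "linear (\<lambda>x. path_coeff B g T (Suc n) i x \<bullet> v)" for i
      using linear_compose[OF linear_path_coeff[OF g] bounded_linear.linear[OF bounded_linear_inner_left]]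
      by (simp add: o_def)
    from X_grid_gaussian[where h="T / real (Suc n)" and n="Suc n", OF _ this] show ?thesis
      unfolding inner_sum_left using \<open>0 < T\<close> by (simp del: sum.cl_ivl_Suc of_nat_Suc)
  qed
  then obtain V where V: "\<And>n. centered_gaussian_char M (?S (Suc n)) (V n)"
    using choice[of "\<lambda>n. centered_gaussian_char M (?S (Suc n))"] by blast
  have [measurable]: "noise T \<in> borel_measurable M"
    using \<open>0 < T\<close> by measurable
  show ?thesis
  proof (rule centered_gaussian_char_LIMSEQ[OF _ _ _ V])
    show "AE \<omega> in M. (\<lambda>n. ?S (Suc n) \<omega>) \<longlonglongrightarrow> noise T \<omega> \<bullet> v"
      by (rule AE_I2, rule tendsto_inner[OF LIMSEQ_Suc[OF noise_LIMSEQ[OF _ \<open>0 < T\<close>]] tendsto_const])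
  qed measurable
qed

lemma reversed_noise_LIMSEQ:
  assumes "\<omega> \<in> space M" "0 < T"
  shows "(\<lambda>n. \<Sum>i=1..n. path_coeff B g T n i
      (X (real n * (T / real n)) \<omega> - X (real (n - i) * (T / real n)) \<omega>)) \<longlonglongrightarrow>
    path_functional B g T (\<lambda>s. X T \<omega> - X (T - s) \<omega>)"
proof -
  have "continuous_on {0..T} (\<lambda>s. X T \<omega> - X (T - s) \<omega>)"
    by (intro continuous_intros continuous_on_compose2[OF continuous_path[OF assms(1), of T]]) auto
  from path_functional_LIMSEQ[OF g this \<open>0 < T\<close>, of B]
  show ?thesis
  proof (rule Lim_transform_eventually)
    have "(\<Sum>i=1..n. path_coeff B g T n i (X T \<omega> - X (T - real i * (T / real n)) \<omega>)) =
      (\<Sum>i=1..n. path_coeff B g T n i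
        (X (real n * (T / real n)) \<omega> - X (real (n - i) * (T / real n)) \<omega>))" if "1 \<le> n" for n
    proof (intro sum.cong refl)
      fix i assume "i \<in> {1..n}"
      then have "real (n - i) * (T / real n) = T - real i * (T / real n)"
        "real n * (T / real n) = T"
        using that by (simp_all add: of_nat_diff field_simps)
      then show "path_coeff B g T n i (X T \<omega> - X (T - real i * (T / real n)) \<omega>) = path_coeff B g T n i
        (X (real n * (T / real n)) \<omega> - X (real (n - i) * (T / real n)) \<omega>)"
        by (simp only:)
    qed
    then show "\<forall>\<^sub>F n in sequentially.
      (\<Sum>i=1..n. path_coeff B g T n i (X T \<omega> - X (T - real i * (T / real n)) \<omega>)) =
      (\<Sum>i=1..n. path_coeff B g T n i
        (X (real n * (T / real n)) \<omega> - X (real (n - i) * (T / real n)) \<omega>))"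
      by (rule eventually_sequentiallyI)
  qed
qed

lemma measurable_reversed_noise:
  "0 < T \<Longrightarrow> (\<lambda>\<omega>. path_functional B g T (\<lambda>s. X T \<omega> - X (T - s) \<omega>)) \<in> borel_measurable M"
  by (rule borel_measurable_LIMSEQ_metric[OF _ reversed_noise_LIMSEQ]) measurable

text \<open>The Riemann sums of both sides have equal expectations under \<open>f\<close> on every
  grid. They converge almost surely, and \<open>f\<close> is bounded and continuous, so the equality
  passes to the limit. The two random variables agree in law only.\<close>

lemma noise_reversal:
  fixes f :: "'b \<Rightarrow> real"
  assumes "0 < T" and f: "continuous_on UNIV f" "bounded (range f)"
  shows "(\<integral>\<omega>. f (path_functional B g T (\<lambda>s. X T \<omega> - X (T - s) \<omega>)) \<partial>M) = (\<integral>\<omega>. f (noise T \<omega>) \<partial>M)"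
proof -
  let ?R = "\<lambda>n \<omega>. \<Sum>i=1..n. path_coeff B g T n i
      (X (real n * (T / real n)) \<omega> - X (real (n - i) * (T / real n)) \<omega>)"
  let ?F = "\<lambda>n \<omega>. \<Sum>i=1..n. path_coeff B g T n i (X (real i * (T / real n)) \<omega>)"
  have [measurable]: "f \<in> borel_measurable borel"
    using f(1) by (rule borel_measurable_continuous_onI)
  have [measurable]: "noise T \<in> borel_measurable M"
    using \<open>0 < T\<close> by measurable
  note R = measurable_reversed_noise[OF \<open>0 < T\<close>]
  have "(\<lambda>n. \<integral>\<omega>. f (?R n \<omega>) \<partial>M) \<longlonglongrightarrow> (\<integral>\<omega>. f (path_functional B g T (\<lambda>s. X T \<omega> - X (T - s) \<omega>)) \<partial>M)"
    by (rule integral_bounded_continuous_LIMSEQ[OF _ R AE_I2[OF reversed_noise_LIMSEQ[OF _ \<open>0 < T\<close>]] f])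
       measurable
  then have "(\<lambda>n. \<integral>\<omega>. f (?R (Suc n) \<omega>) \<partial>M) \<longlonglongrightarrow>
      (\<integral>\<omega>. f (path_functional B g T (\<lambda>s. X T \<omega> - X (T - s) \<omega>)) \<partial>M)"
    by (rule LIMSEQ_Suc)
  moreover have "(\<integral>\<omega>. f (?R (Suc n) \<omega>) \<partial>M) = (\<integral>\<omega>. f (?F (Suc n) \<omega>) \<partial>M)" for n
    using \<open>0 < T\<close> by (intro X_grid_reversal linear_path_coeff[OF g]) auto
  ultimately have "(\<lambda>n. \<integral>\<omega>. f (?F (Suc n) \<omega>) \<partial>M) \<longlonglongrightarrow>
      (\<integral>\<omega>. f (path_functional B g T (\<lambda>s. X T \<omega> - X (T - s) \<omega>)) \<partial>M)"
    by (simp only:)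
  moreover have "(\<lambda>n. \<integral>\<omega>. f (?F n \<omega>) \<partial>M) \<longlonglongrightarrow> (\<integral>\<omega>. f (noise T \<omega>) \<partial>M)"
    by (rule integral_bounded_continuous_LIMSEQ[OF _ _ AE_I2[OF noise_LIMSEQ[OF _ \<open>0 < T\<close>]] f])
       measurable
  then have "(\<lambda>n. \<integral>\<omega>. f (?F (Suc n) \<omega>) \<partial>M) \<longlonglongrightarrow> (\<integral>\<omega>. f (noise T \<omega>) \<partial>M)"
    by (rule LIMSEQ_Suc)
  ultimately show ?thesis
    by (rule LIMSEQ_unique)
qed

text \<open>A continuous path is the limit of step paths that read \<open>X\<close> at the last grid
  point, and each step process is pieced together from countably many measurable variables. Joint
  measurability is what the exchange of time and probability integrals rests on.\<close>

lemma path_jointly_measurable: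
  "(\<lambda>z. X (max 0 (snd z)) (fst z)) \<in> borel_measurable (M \<Otimes>\<^sub>M (lborel :: real measure))"
proof (rule borel_measurable_LIMSEQ_metric)
  let ?k = "\<lambda>n (s :: real). nat \<lfloor>s * real (Suc n)\<rfloor>"
  show "(\<lambda>z. X (real (?k n (snd z)) / real (Suc n)) (fst z)) \<in> borel_measurable (M \<Otimes>\<^sub>M lborel)" for n :: nat
    by (rule measurable_compose_countable[where f="\<lambda>k z. X (real k / real (Suc n)) (fst z)"]) measurable
  fix z assume z: "z \<in> space (M \<Otimes>\<^sub>M (lborel :: real measure))"
  then have \<omega>: "fst z \<in> space M" by (auto simp: space_pair_measure)
  let ?s = "max 0 (snd z)"
  have "\<bar>real (?k n (snd z)) / real (Suc n) - ?s\<bar> \<le> inverse (real (Suc n))" for n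
  proof -
    have "real (?k n (snd z)) \<le> ?s * real (Suc n)" "?s * real (Suc n) \<le> real (?k n (snd z)) + 1"
    proof -
      \<comment> \<open>\<open>nat\<close> sends the floor of a negative number to \<open>0\<close>,
        which matches the cut-off by \<open>max 0\<close>.\<close>
      have "?k n (snd z) = ?k n ?s"
      proof (cases "0 \<le> snd z")
        case False
        then have "snd z * real (Suc n) < 0 + 1"
          using mult_nonpos_nonneg[of "snd z" "real (Suc n)"] by linarith
        then have "\<lfloor>snd z * real (Suc n)\<rfloor> \<le> 0"
          unfolding floor_le_zero by simp
        with False show ?thesis by simp
      qed simp
      moreover have "0 \<le> \<lfloor>?s * real (Suc n)\<rfloor>" by simp
      ultimately have "real (?k n (snd z)) = real_of_int \<lfloor>?s * real (Suc n)\<rfloor>" by simp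
      then show "real (?k n (snd z)) \<le> ?s * real (Suc n)" "?s * real (Suc n) \<le> real (?k n (snd z)) + 1"
        by (simp_all only: of_int_floor_le) linarith
    qed
    then have "\<bar>real (?k n (snd z)) - ?s * real (Suc n)\<bar> \<le> 1"
      by linarith
    from divide_right_mono[OF this, of "real (Suc n)"]
    have "\<bar>(real (?k n (snd z)) - ?s * real (Suc n)) / real (Suc n)\<bar> \<le> inverse (real (Suc n))"
      by (simp add: inverse_eq_divide)
    then show ?thesis
      unfolding diff_divide_distrib by (simp del: of_nat_Suc)
  qed
  then have "(\<lambda>n. real (?k n (snd z)) / real (Suc n)) \<longlonglongrightarrow> ?s"
    by (intro LIM_zero_cancel[OF Lim_null_comparison[OF _ LIMSEQ_inverse_real_of_nat]])
       (auto simp: eventually_sequentially)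
  then show "(\<lambda>n. X (real (?k n (snd z)) / real (Suc n)) (fst z)) \<longlonglongrightarrow> X ?s (fst z)"
    by (rule continuous_on_tendsto_compose[OF continuous_X[OF \<omega>]]) auto
qed

lemma kernel_jointly_measurable:
  "(\<lambda>(\<omega>, s). kernel \<omega> s) \<in> borel_measurable (M \<Otimes>\<^sub>M lborel)"
proof -
  have [measurable]: "(\<lambda>z. X (max 0 (snd z)) (fst z)) \<in> borel_measurable (M \<Otimes>\<^sub>M (lborel :: real measure))"
    by (rule path_jointly_measurable)
  have "(\<lambda>(s, x). (flow B s * B) \<cdot>\<^sub>E x) \<in> borel_measurable (borel :: (real \<times> 'b) measure)"
    unfolding case_prod_beta
    by (intro borel_measurable_continuous_onI bounded_bilinear.continuous_on[OF bounded_bilinear_endo_apply]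
        continuous_intros)
  then have [measurable]: "(\<lambda>(s, x). (flow B s * B) \<cdot>\<^sub>E x) \<in> borel_measurable (borel \<Otimes>\<^sub>M borel)"
    by (simp add: borel_prod)
  have "(\<lambda>z. (flow B (snd z) * B) \<cdot>\<^sub>E g (X (max 0 (snd z)) (fst z)))
      = (\<lambda>z. (\<lambda>(s, x). (flow B s * B) \<cdot>\<^sub>E x) (snd z, g (X (max 0 (snd z)) (fst z))))"
    by simp
  also have "\<dots> \<in> borel_measurable (M \<Otimes>\<^sub>M lborel)"
    by measurable
  finally have [measurable]: "(\<lambda>z. (flow B (snd z) * B) \<cdot>\<^sub>E g (X (max 0 (snd z)) (fst z)))
      \<in> borel_measurable (M \<Otimes>\<^sub>M lborel)" .
  show ?thesis
    unfolding kernel_def case_prod_beta by measurable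
qed

lemma nn_integral_norm_le:
  assumes "0 \<le> t" and Y: "\<And>\<omega>. norm (Y \<omega> :: 'b) \<le> C * exp (- c * t) * norm (X t \<omega>)"
  shows "(\<integral>\<^sup>+\<omega>. ennreal (norm (Y \<omega>)) \<partial>M)
    \<le> ennreal (C * real CARD('n) * (1 + 2 / c) * exp (- (c / 2) * t))"
proof -
  have "(\<integral>\<^sup>+\<omega>. ennreal (norm (Y \<omega>)) \<partial>M) \<le> (\<integral>\<^sup>+\<omega>. ennreal (C * exp (- c * t) * norm (X t \<omega>)) \<partial>M)"
    by (intro nn_integral_mono ennreal_leI Y)
  also have "\<dots> = ennreal (\<integral>\<omega>. C * exp (- c * t) * norm (X t \<omega>) \<partial>M)"
    using X_norm_moment(1)[OF \<open>0 \<le> t\<close>] C_nonneg by (intro nn_integral_eq_integral) auto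
  also have "(\<integral>\<omega>. C * exp (- c * t) * norm (X t \<omega>) \<partial>M) = C * exp (- c * t) * expectation (\<lambda>\<omega>. norm (X t \<omega>))"
    by simp
  also have "\<dots> \<le> C * exp (- c * t) * (real CARD('n) * (1 + t))"
    using X_norm_moment(2)[OF \<open>0 \<le> t\<close>] C_nonneg by (intro mult_left_mono) auto
  also have "\<dots> = C * real CARD('n) * (exp (- c * t) * (1 + t))"
    by simp
  also have "\<dots> \<le> C * real CARD('n) * ((1 + 2 / c) * exp (- (c / 2) * t))"
    using exp_linear_le_exp_half[OF c \<open>0 \<le> t\<close>] C_nonneg by (intro mult_left_mono) auto
  finally show ?thesis
    by (simp add: mult.assoc ennreal_leI)
qed

text \<open>By Tonelli the expected time integral of the norm is the time integral of first moments,
  which decay exponentially; a nonnegative variable with finite expectation is almost surely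
  finite.\<close>

lemma kernel_integrable: "AE \<omega> in M. integrable lborel (kernel \<omega>)"
proof -
  interpret pair_sigma_finite M "lborel :: real measure" ..
  let ?K = "C * real CARD('n) * (1 + 2 / c)"
  have K: "0 \<le> ?K" using C_nonneg c by simp
  have [measurable]: "(\<lambda>(\<omega>, s). kernel \<omega> s) \<in> borel_measurable (M \<Otimes>\<^sub>M lborel)"
    by (rule kernel_jointly_measurable)
  have "(\<integral>\<^sup>+\<omega>. (\<integral>\<^sup>+s. ennreal (norm (kernel \<omega> s)) \<partial>lborel) \<partial>M)
      = (\<integral>\<^sup>+s. (\<integral>\<^sup>+\<omega>. ennreal (norm (kernel \<omega> s)) \<partial>M) \<partial>lborel)"
    by (rule Fubini'[symmetric]) measurable
  also have "\<dots> \<le> (\<integral>\<^sup>+s. ennreal (indicator {0..} s * (?K * exp (- (c / 2) * s))) \<partial>lborel)"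
  proof (rule nn_integral_mono)
    fix s :: real
    show "(\<integral>\<^sup>+\<omega>. ennreal (norm (kernel \<omega> s)) \<partial>M) \<le> ennreal (indicator {0..} s * (?K * exp (- (c / 2) * s)))"
    proof (cases "0 \<le> s")
      case True
      from nn_integral_norm_le[OF True, of "\<lambda>\<omega>. (flow B s * B) \<cdot>\<^sub>E g (X s \<omega>)"] kernel_decay[OF True]
      show ?thesis using True by (simp add: kernel_def)
    qed (simp add: kernel_def)
  qed
  also have "\<dots> = ennreal (?K * (exp (- (c / 2) * 0) / (c / 2)))"
    using K c by (intro nn_integral_has_integral_lebesgue has_integral_mult_right
        has_integral_exp_minus_to_infinity) auto
  finally have "(\<integral>\<^sup>+\<omega>. (\<integral>\<^sup>+s. ennreal (norm (kernel \<omega> s)) \<partial>lborel) \<partial>M) \<noteq> \<infinity>"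
    by (metis ennreal_neq_top infinity_ennreal_def neq_top_trans)
  then have "AE \<omega> in M. (\<integral>\<^sup>+s. ennreal (norm (kernel \<omega> s)) \<partial>lborel) \<noteq> \<infinity>"
    by (intro nn_integral_PInf_AE) measurable
  with AE_space show ?thesis
  proof eventually_elim
    case (elim \<omega>)
    have "kernel \<omega> \<in> borel_measurable lborel"
      using measurable_compose[OF measurable_Pair1'[OF elim(1)] kernel_jointly_measurable] by simp
    with elim(2) show ?case
      by (intro integrableI_bounded) (auto simp: top.not_eq_extremum)
  qed
qed

lemma measurable_limit_noise [measurable]: "limit_noise \<in> borel_measurable M"
  unfolding limit_noise_def[abs_def] using kernel_jointly_measurable
  by (intro borel_measurable_uminus lborel.borel_measurable_lebesgue_integral)

text \<open>Truncating \<open>kernel\<close> at \<open>T\<close> reproduces the ordinary integral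
  over \<open>{0..T}\<close>, so absolute integrability forces the truncations to converge.\<close>

lemma integral_tail_LIMSEQ:
  assumes "integrable lborel (kernel \<omega>)" "filterlim t at_top sequentially"
  shows "(\<lambda>n. integral {0..t n} (\<lambda>s. (flow B s * B) \<cdot>\<^sub>E g (X s \<omega>))) \<longlonglongrightarrow> - limit_noise \<omega>"
proof -
  have "(LINT s|lborel. indicator {..T} s *\<^sub>R kernel \<omega> s)
      = integral {0..T} (\<lambda>s. (flow B s * B) \<cdot>\<^sub>E g (X s \<omega>))" for T
  proof -
    have "set_integrable lborel {..T} (kernel \<omega>)"
      using assms(1) by (intro integrable_mult_indicator[of _ lborel, folded set_integrable_def]) auto
    then have "(LINT s|lborel. indicator {..T} s *\<^sub>R kernel \<omega> s) = integral {..T} (kernel \<omega>)"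
      using set_borel_integral_eq_integral(2) by (simp add: set_lebesgue_integral_def)
    also have "\<dots> = integral {0..T} (\<lambda>s. (flow B s * B) \<cdot>\<^sub>E g (X s \<omega>))"
      by (subst (1 2) integral_restrict_UNIV[symmetric])
         (rule arg_cong[where f="integral UNIV"], auto simp: fun_eq_iff kernel_def)
    finally show ?thesis .
  qed
  moreover have "((\<lambda>T. LINT s|lborel. indicator {..T} s *\<^sub>R kernel \<omega> s) \<longlongrightarrow> (LINT s|lborel. kernel \<omega> s)) at_top"
    using assms(1) by (intro tendsto_integral_at_top) auto
  ultimately show ?thesis
    using filterlim_compose[OF _ assms(2)] by (simp add: limit_noise_def)
qed

text \<open>The boundary term \<open>exp (t B) g (X t)\<close> is only controlled in mean, hence the restriction to
  sequences of times; for convergence in distribution this is enough.\<close>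

lemma noise_AE_LIMSEQ:
  assumes t: "\<And>n. real n \<le> t n"
  shows "AE \<omega> in M. (\<lambda>n. noise (t n) \<omega>) \<longlonglongrightarrow> limit_noise \<omega>"
proof -
  let ?K = "C * real CARD('n) * (1 + 2 / c)"
  have K: "0 \<le> ?K" using C_nonneg c by simp
  have t0: "0 \<le> t n" for n using t[of n] by (rule order_trans[rotated]) simp
  have lim: "filterlim t at_top sequentially"
    by (rule filterlim_at_top_mono[OF filterlim_real_sequentially]) (simp add: t)
  \<comment> \<open>Since \<open>t n\<close> is at least \<open>n\<close>, the first moments are
    bounded by a geometric sequence with ratio \<open>exp (- (c / 2))\<close>.\<close>
  have "AE \<omega> in M. (\<lambda>n. flow B (t n) \<cdot>\<^sub>E g (X (t n) \<omega>)) \<longlonglongrightarrow> 0"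
  proof (rule AE_LIMSEQ_0_if_geometric_moments[OF _ _ K])
    show "(\<integral>\<^sup>+\<omega>. ennreal (norm (flow B (t n) \<cdot>\<^sub>E g (X (t n) \<omega>))) \<partial>M) \<le> ennreal (?K * exp (- (c / 2)) ^ n)" for n
    proof -
      have "exp (- (c / 2) * t n) \<le> exp (- (c / 2)) ^ n"
        using c mult_left_mono[OF t[of n], of "c / 2"] by (simp add: exp_of_nat_mult[symmetric] mult.commute)
      then have "?K * exp (- (c / 2) * t n) \<le> ?K * exp (- (c / 2)) ^ n"
        by (rule mult_left_mono[OF _ K])
      with nn_integral_norm_le[OF t0 flow_decay[OF t0]] show ?thesis
        by (meson ennreal_leI order_trans)
    qed
  qed (use c in auto)
  moreover note kernel_integrable
  ultimately show ?thesis
  proof eventually_elim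
    case (elim \<omega>)
    from tendsto_diff[OF elim(1) integral_tail_LIMSEQ[OF elim(2) lim]]
    show ?case by (simp add: noise_def path_functional_def)
  qed
qed

lemma noise_converges_in_distribution:
  fixes f :: "'b \<Rightarrow> real"
  assumes f: "continuous_on UNIV f" "bounded (range f)" and m: "(m \<longlongrightarrow> m') at_top"
  shows "((\<lambda>T. \<integral>\<omega>. f (m T + noise T \<omega>) \<partial>M) \<longlongrightarrow> (\<integral>\<omega>. f (m' + limit_noise \<omega>) \<partial>M)) at_top"
proof (rule tendsto_at_top_if_sequences)
  fix t :: "nat \<Rightarrow> real" assume t: "\<And>n. real n \<le> t n"
  then have lim: "filterlim t at_top sequentially"
    by (intro filterlim_at_top_mono[OF filterlim_real_sequentially]) simp
  \<comment> \<open>The index is shifted because \<open>t 0\<close> may be \<open>0\<close>, while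
    \<open>noise\<close> is known to be measurable at positive times only.\<close>
  have pos: "0 < t (Suc n)" for n
    using t[of "Suc n"] by (rule less_le_trans[rotated]) simp
  have [measurable]: "noise (t (Suc n)) \<in> borel_measurable M" for n
    using pos by measurable
  have "(\<lambda>n. \<integral>\<omega>. f (m (t (Suc n)) + noise (t (Suc n)) \<omega>) \<partial>M) \<longlonglongrightarrow> (\<integral>\<omega>. f (m' + limit_noise \<omega>) \<partial>M)"
  proof (rule integral_bounded_continuous_LIMSEQ[OF _ _ _ f])
    show "AE \<omega> in M. (\<lambda>n. m (t (Suc n)) + noise (t (Suc n)) \<omega>) \<longlonglongrightarrow> m' + limit_noise \<omega>"
      using noise_AE_LIMSEQ[of t, OF t]
      by eventually_elim (rule LIMSEQ_Suc[OF tendsto_add[OF filterlim_compose[OF m lim]]])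
  qed measurable
  then show "(\<lambda>n. \<integral>\<omega>. f (m (t n) + noise (t n) \<omega>) \<partial>M) \<longlonglongrightarrow> (\<integral>\<omega>. f (m' + limit_noise \<omega>) \<partial>M)"
    by (rule LIMSEQ_imp_Suc)
qed

lemma limit_noise_gaussian: "\<exists>V. centered_gaussian_char M (\<lambda>\<omega>. limit_noise \<omega> \<bullet> v) V"
proof -
  have "\<exists>V. centered_gaussian_char M (\<lambda>\<omega>. noise (real (Suc n)) \<omega> \<bullet> v) V" for n
    by (rule noise_gaussian) simp
  then obtain V where V: "\<And>n. centered_gaussian_char M (\<lambda>\<omega>. noise (real (Suc n)) \<omega> \<bullet> v) (V n)"
    using choice[of "\<lambda>n. centered_gaussian_char M (\<lambda>\<omega>. noise (real (Suc n)) \<omega> \<bullet> v)"] by blast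
  have [measurable]: "noise (real (Suc n)) \<in> borel_measurable M" for n
    by (rule measurable_noise) simp
  show ?thesis
  proof (rule centered_gaussian_char_LIMSEQ[OF _ _ _ V])
    show "AE \<omega> in M. (\<lambda>n. noise (real (Suc n)) \<omega> \<bullet> v) \<longlonglongrightarrow> limit_noise \<omega> \<bullet> v"
      using noise_AE_LIMSEQ[of "\<lambda>n. real (Suc n)"]
      by (auto elim!: eventually_mono intro: tendsto_inner[OF _ tendsto_const])
  qed measurable
qed

end

section \<open>From centred projections to Gaussian measures with a mean\<close>

lemma (in prob_space) normal_distribution_shift:
  assumes [measurable]: "Y \<in> borel_measurable M" and Y: "distr M borel Y = normal_distribution 0 s"
    and "0 \<le> s"
  shows "distr M borel (\<lambda>\<omega>. a + Y \<omega>) = normal_distribution a s"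
proof -
  have eq: "distr M borel (\<lambda>\<omega>. a + Y \<omega>) = distr (normal_distribution 0 s) borel (\<lambda>x. a + x)"
    unfolding Y[symmetric] by (subst distr_distr) (auto simp: o_def)
  show ?thesis
  proof (cases "s = 0")
    case True
    then show ?thesis
      unfolding eq by (simp add: normal_distribution_def distr_return)
  next
    case False
    with \<open>0 \<le> s\<close> have "0 < s" by simp
    have "distributed M lborel Y (normal_density 0 s)"
      using Y \<open>0 < s\<close> by (simp add: distributed_def normal_distribution_def cong: distr_cong)
    from normal_density_affine[OF this \<open>0 < s\<close>, of 1 a]
    have "distributed M lborel (\<lambda>\<omega>. a + Y \<omega>) (normal_density a s)"
      by simp
    from distributed_distr_eq_density[OF this] show ?thesis
      using \<open>0 < s\<close> by (simp add: normal_distribution_def cong: distr_cong)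
  qed
qed

text \<open>\<open>gaussian_measure\<close> looks only at one-dimensional projections, where the
  shift by \<open>m\<close> moves the mean by \<open>m \<bullet> v\<close>. Integrability and the
  mean of the vector are recovered from its coordinates.\<close>

lemma (in prob_space) gaussian_measure_distr_shift:
  fixes Y :: "'a \<Rightarrow> 'b::euclidean_space" and m :: 'b
  assumes [measurable]: "Y \<in> borel_measurable M"
    and gauss: "\<And>v. \<exists>V. centered_gaussian_char M (\<lambda>\<omega>. Y \<omega> \<bullet> v) V"
  defines "\<nu> \<equiv> distr M borel (\<lambda>\<omega>. m + Y \<omega>)"
  shows "gaussian_measure \<nu>" "integrable \<nu> (\<lambda>z. z)" "integral\<^sup>L \<nu> (\<lambda>z. z) = m"
proof -
  have normal: "\<exists>s\<ge>0. distr M borel (\<lambda>\<omega>. Y \<omega> \<bullet> v) = normal_distribution 0 s" for v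
  proof -
    obtain V where V: "centered_gaussian_char M (\<lambda>\<omega>. Y \<omega> \<bullet> v) V" using gauss by blast
    then have "distr M borel (\<lambda>\<omega>. Y \<omega> \<bullet> v) = normal_distribution 0 (sqrt V)"
      by (intro centered_gaussian_char_imp_normal) measurable
    moreover have "0 \<le> sqrt V" using V by (simp add: centered_gaussian_char_def)
    ultimately show ?thesis by blast
  qed
  show "gaussian_measure \<nu>"
    unfolding gaussian_measure_def
  proof (intro conjI allI)
    show "prob_space \<nu>" unfolding \<nu>_def by (rule prob_space_distr) measurable
    show "sets \<nu> = sets borel" by (simp add: \<nu>_def)
    fix v
    obtain s where s: "0 \<le> s" "distr M borel (\<lambda>\<omega>. Y \<omega> \<bullet> v) = normal_distribution 0 s"
      using normal by blast
    have "distr \<nu> borel (\<lambda>x. x \<bullet> v) = distr M borel (\<lambda>\<omega>. m \<bullet> v + Y \<omega> \<bullet> v)"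
      unfolding \<nu>_def by (subst distr_distr) (auto simp: o_def inner_add_left)
    also have "\<dots> = normal_distribution (m \<bullet> v) s"
      using s by (intro normal_distribution_shift) auto
    finally show "\<exists>m s. 0 \<le> s \<and> distr \<nu> borel (\<lambda>x. x \<bullet> v) = normal_distribution m s"
      using s(1) by blast
  qed
  have comp: "integrable M (\<lambda>\<omega>. Y \<omega> \<bullet> v)" "expectation (\<lambda>\<omega>. Y \<omega> \<bullet> v) = 0" for v
  proof -
    obtain s where s: "0 \<le> s" "distr M borel (\<lambda>\<omega>. Y \<omega> \<bullet> v) = normal_distribution 0 s"
      using normal by blast
    show "integrable M (\<lambda>\<omega>. Y \<omega> \<bullet> v)"
      using char_normal_distribution(3)[OF s(1)] unfolding s(2)[symmetric]
      by (subst (asm) integrable_distr_eq) auto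
    show "expectation (\<lambda>\<omega>. Y \<omega> \<bullet> v) = 0"
      using char_normal_distribution(4)[OF s(1)] unfolding s(2)[symmetric]
      by (subst (asm) integral_distr) auto
  qed
  have "integrable M (\<lambda>\<omega>. \<Sum>b\<in>Basis. (Y \<omega> \<bullet> b) *\<^sub>R b)"
    by (intro Bochner_Integration.integrable_sum integrable_scaleR_left comp)
  then have int: "integrable M Y"
    by (simp add: euclidean_representation)
  have mean: "expectation Y = 0"
  proof (rule euclidean_eqI)
    fix b :: 'b
    show "expectation Y \<bullet> b = 0 \<bullet> b"
      using integral_inner_left[OF int, of b] comp(2)[of b] by simp
  qed
  show "integrable \<nu> (\<lambda>z. z)"
    unfolding \<nu>_def using int by (subst integrable_distr_eq) auto
  have "integral\<^sup>L \<nu> (\<lambda>z. z) = expectation (\<lambda>\<omega>. m + Y \<omega>)"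
    unfolding \<nu>_def by (rule integral_distr) measurable
  also have "\<dots> = expectation (\<lambda>\<omega>. m) + expectation Y"
    using int by (intro Bochner_Integration.integral_add) auto
  finally show "integral\<^sup>L \<nu> (\<lambda>z. z) = m"
    unfolding mean by (simp add: prob_space)
qed

section \<open>The agent system\<close>

text \<open>The distances are cyclic forward differences, whose sum telescopes to \<open>0\<close>,
  plus one extra \<open>L\<close> at the wrap-around.\<close>

lemma sum_distances: "(\<Sum>n\<in>UNIV. distances L q $ n) = L"
proof -
  have "distances L q $ n = forward_diff q $ n + (if n = Max UNIV then L else 0)" for n
    by (simp add: distances_def forward_diff_def succ_agent_def)
  then show ?thesis
    by (simp add: sum.distrib sum_forward_diff)
qed

lemma deriv_quadratic_potential: "deriv (quadratic_potential \<alpha>) x = \<alpha>\<^sup>2 * x"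
  by (rule DERIV_imp_deriv)
     (auto intro!: derivative_eq_intros simp: quadratic_potential_def[abs_def] power2_eq_square)

text \<open>The matrix G of the model.\<close>

definition velocity_noise :: "real \<Rightarrow> (real, 'n::finite) vec \<Rightarrow> (real, 'n) vec \<times> (real, 'n) vec"
  where "velocity_noise \<sigma> x = (0, \<sigma> *\<^sub>R x)"

lemma bounded_linear_velocity_noise: "bounded_linear (velocity_noise \<sigma>)"
  unfolding velocity_noise_def[abs_def]
  by (intro bounded_linear_Pair bounded_linear_zero bounded_linear_scaleR_right)

text \<open>Noise has distance part \<open>0\<close>, and applying \<open>B\<close> gives distances
  that are forward differences and hence sum to \<open>0\<close>; so the flow decays on both. The
  factor \<open>1 + norm B\<close> lets one constant serve both estimates.\<close>

lemma velocity_noise_decay: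
  assumes "0 < \<alpha>" "0 < \<beta>" "0 < \<gamma>"
  defines "B \<equiv> Endo (drift \<alpha> \<beta> \<gamma>)"
  shows "\<exists>C. \<exists>c>0. \<forall>t\<ge>0. \<forall>x :: (real, 'n::{finite,linorder}) vec.
    norm (flow B t \<cdot>\<^sub>E velocity_noise \<sigma> x) \<le> C * exp (- c * t) * norm x \<and>
    norm ((flow B t * B) \<cdot>\<^sub>E velocity_noise \<sigma> x) \<le> C * exp (- c * t) * norm x"
proof -
  obtain C c where "0 < C" "0 < c" and decay: "\<And>t v :: (real, 'n) vec \<times> (real, 'n) vec.
      0 \<le> t \<Longrightarrow> (\<Sum>n\<in>UNIV. fst v $ n) = 0 \<Longrightarrow> norm (flow B t \<cdot>\<^sub>E v) \<le> C * exp (- c * t) * norm v"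
    using drift_flow_decay[OF assms(1-3)] unfolding B_def by blast
  let ?g = "velocity_noise \<sigma> :: (real, 'n) vec \<Rightarrow> _"
  have g: "norm (?g x) = \<bar>\<sigma>\<bar> * norm x" for x
    by (simp add: velocity_noise_def norm_prod_def)
  have "norm (flow B t \<cdot>\<^sub>E ?g x) \<le> C * (\<bar>\<sigma>\<bar> * (1 + norm B)) * exp (- c * t) * norm x"
    "norm ((flow B t * B) \<cdot>\<^sub>E ?g x) \<le> C * (\<bar>\<sigma>\<bar> * (1 + norm B)) * exp (- c * t) * norm x"
    if "0 \<le> t" for t x
  proof -
    have scale: "C * exp (- c * t) * y \<le> C * (\<bar>\<sigma>\<bar> * (1 + norm B)) * exp (- c * t) * norm x"
      if "y \<le> \<bar>\<sigma>\<bar> * (1 + norm B) * norm x" for y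
      using mult_left_mono[OF that, of "C * exp (- c * t)"] \<open>0 < C\<close> by (simp add: mult_ac)
    have "norm (flow B t \<cdot>\<^sub>E ?g x) \<le> C * exp (- c * t) * norm (?g x)"
      by (rule decay[OF that]) (simp add: velocity_noise_def)
    also have "\<dots> \<le> C * (\<bar>\<sigma>\<bar> * (1 + norm B)) * exp (- c * t) * norm x"
      by (rule scale) (simp add: g algebra_simps)
    finally show "norm (flow B t \<cdot>\<^sub>E ?g x) \<le> C * (\<bar>\<sigma>\<bar> * (1 + norm B)) * exp (- c * t) * norm x" .
    have "(\<Sum>n\<in>UNIV. fst (B \<cdot>\<^sub>E ?g x) $ n) = 0"
      by (simp add: B_def Endo_apply bounded_linear_drift drift_def sum_forward_diff)
    from decay[OF that this]
    have "norm ((flow B t * B) \<cdot>\<^sub>E ?g x) \<le> C * exp (- c * t) * norm (B \<cdot>\<^sub>E ?g x)"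
      by (simp add: endo_apply_times)
    also have "\<dots> \<le> C * (\<bar>\<sigma>\<bar> * (1 + norm B)) * exp (- c * t) * norm x"
    proof (rule scale)
      have "norm (B \<cdot>\<^sub>E ?g x) \<le> norm B * (\<bar>\<sigma>\<bar> * norm x)"
        using norm_endo_apply[of B "?g x"] by (simp add: g)
      also have "\<dots> \<le> \<bar>\<sigma>\<bar> * (1 + norm B) * norm x"
        by (simp add: algebra_simps)
      finally show "norm (B \<cdot>\<^sub>E ?g x) \<le> \<bar>\<sigma>\<bar> * (1 + norm B) * norm x" .
    qed
    finally show "norm ((flow B t * B) \<cdot>\<^sub>E ?g x) \<le> C * (\<bar>\<sigma>\<bar> * (1 + norm B)) * exp (- c * t) * norm x" .
  qed
  with \<open>0 < c\<close> show ?thesis by blast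
qed

text \<open>After subtraction of the uniform configuration with the same total distance, which the
  flow fixes, the remainder has sum \<open>0\<close> and decays.\<close>

lemma drift_flow_tendsto_equilibrium:
  fixes v :: "(real, 'n::{finite,linorder}) vec \<times> (real, 'n) vec"
  assumes "0 < \<alpha>" "0 < \<beta>" "0 < \<gamma>" and sum: "(\<Sum>n\<in>UNIV. fst v $ n) = L"
  shows "((\<lambda>t. drift_flow \<alpha> \<beta> \<gamma> t \<cdot>\<^sub>E v) \<longlongrightarrow> ((\<chi> n. L / real CARD('n)), 0)) at_top"
proof -
  obtain C c where "0 < C" "0 < c" and decay: "\<And>t v :: (real, 'n) vec \<times> (real, 'n) vec.
      0 \<le> t \<Longrightarrow> (\<Sum>n\<in>UNIV. fst v $ n) = 0 \<Longrightarrow>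
      norm (drift_flow \<alpha> \<beta> \<gamma> t \<cdot>\<^sub>E v) \<le> C * exp (- c * t) * norm v"
    using drift_flow_decay[OF assms(1-3)] by blast
  let ?m = "((\<chi> n. L / real CARD('n)), 0) :: (real, 'n) vec \<times> (real, 'n) vec"
  have "(\<Sum>n\<in>UNIV. fst (v - ?m) $ n) = 0"
    by (simp add: sum_subtractf sum)
  note bound = decay[OF _ this]
  have "((\<lambda>t. exp (- c * t)) \<longlongrightarrow> 0) at_top"
    using \<open>0 < c\<close> by real_asymp
  then have "((\<lambda>t. C * exp (- c * t) * norm (v - ?m)) \<longlongrightarrow> C * 0 * norm (v - ?m)) at_top"
    by (intro tendsto_intros)
  then have "((\<lambda>t. drift_flow \<alpha> \<beta> \<gamma> t \<cdot>\<^sub>E (v - ?m)) \<longlongrightarrow> 0) at_top"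
    by (intro Lim_null_comparison[OF eventually_mono[OF eventually_ge_at_top[of 0] bound]]) simp_all
  moreover have "drift_flow \<alpha> \<beta> \<gamma> t \<cdot>\<^sub>E (v - ?m) = drift_flow \<alpha> \<beta> \<gamma> t \<cdot>\<^sub>E v - ?m" for t
    by (simp add: endo.diff_right drift_flow_uniform)
  ultimately show ?thesis
    by (simp add: LIM_zero_iff)
qed

text \<open>Centring at \<open>u\<close> turns the relaxation term into a linear one, and the
  constant disappears from the forward differences. The \<beta>-term is minus
  \<open>backward_diff\<close> after \<open>forward_diff\<close>, the discrete Laplacian on the
  cycle.\<close>

lemma agent_sde_integral_equation:
  fixes Q p :: "real \<Rightarrow> (real, 'n::{finite,linorder}) vec"
  assumes Q: "continuous_on {0..} Q" and p: "continuous_on {0..} p"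
    and eq: "\<And>t n. 0 \<le> t \<Longrightarrow>
           Q t $ n = Q0 $ n + integral {0..t} (\<lambda>s. p s $ succ_agent n - p s $ n) \<and>
           p t $ n = p0 $ n
             + integral {0..t} (\<lambda>s. (deriv (quadratic_potential \<alpha>) (Q s $ n)
                 - deriv (quadratic_potential \<alpha>) (Q s $ pred_agent n))
                 + \<beta> * (p s $ succ_agent n - 2 * p s $ n + p s $ pred_agent n)
                 + \<gamma> * (u - p s $ n))
             + \<sigma> * W t $ n"
    and "0 \<le> t"
  shows "(Q t, p t - (\<chi> n. u)) = (Q0, p0 - (\<chi> n. u))
    + integral {0..t} (\<lambda>s. Endo (drift \<alpha> \<beta> \<gamma>) \<cdot>\<^sub>E (Q s, p s - (\<chi> n. u))) + velocity_noise \<sigma> (W t)"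
proof -
  let ?F = "\<lambda>s. Endo (drift \<alpha> \<beta> \<gamma>) \<cdot>\<^sub>E (Q s, p s - (\<chi> n. u))"
  have "continuous_on {0..t} ?F"
    by (intro bounded_linear.continuous_on[OF endo.bounded_linear_right] continuous_intros
        continuous_on_subset[OF Q] continuous_on_subset[OF p]) auto
  then have int: "?F integrable_on {0..t}"
    by (rule integrable_continuous_real)
  have F: "?F s = (forward_diff (p s - (\<chi> n. u)), - (\<alpha>\<^sup>2 *\<^sub>R backward_diff (Q s))
      - \<beta> *\<^sub>R backward_diff (forward_diff (p s - (\<chi> n. u))) - \<gamma> *\<^sub>R (p s - (\<chi> n. u)))" for s
    by (simp add: Endo_apply bounded_linear_drift) (simp add: drift_def)
  have "fst (integral {0..t} ?F) $ n = integral {0..t} (\<lambda>s. p s $ succ_agent n - p s $ n)" for n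
  proof -
    have "bounded_linear (\<lambda>z :: (real, 'n) vec \<times> (real, 'n) vec. fst z $ n)"
      by (intro bounded_linear_compose[OF bounded_linear_vec_nth bounded_linear_fst])
    from integral_linear[OF int this] show ?thesis
      by (simp add: o_def F forward_diff_def)
  qed
  moreover have "snd (integral {0..t} ?F) $ n = integral {0..t} (\<lambda>s.
      (deriv (quadratic_potential \<alpha>) (Q s $ n) - deriv (quadratic_potential \<alpha>) (Q s $ pred_agent n))
      + \<beta> * (p s $ succ_agent n - 2 * p s $ n + p s $ pred_agent n) + \<gamma> * (u - p s $ n))" for n
  proof -
    have "bounded_linear (\<lambda>z :: (real, 'n) vec \<times> (real, 'n) vec. snd z $ n)"
      by (intro bounded_linear_compose[OF bounded_linear_vec_nth bounded_linear_snd])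
    from integral_linear[OF int this, symmetric]
    have "snd (integral {0..t} ?F) $ n = integral {0..t} (\<lambda>s. snd (?F s) $ n)"
      by (simp only: o_def)
    also have "(\<lambda>s. snd (?F s) $ n) = (\<lambda>s.
      (deriv (quadratic_potential \<alpha>) (Q s $ n) - deriv (quadratic_potential \<alpha>) (Q s $ pred_agent n))
      + \<beta> * (p s $ succ_agent n - 2 * p s $ n + p s $ pred_agent n) + \<gamma> * (u - p s $ n))"
      by (simp add: F forward_diff_def backward_diff_def succ_pred_agent deriv_quadratic_potential
          fun_eq_iff algebra_simps)
    finally show ?thesis .
  qed
  ultimately show ?thesis
    using eq[OF \<open>0 \<le> t\<close>] by (simp add: prod_eq_iff vec_eq_iff velocity_noise_def)
qed

theorem proposition9:
  fixes M :: "'a measure"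
    and W Q p :: "real \<Rightarrow> 'a \<Rightarrow> (real, 'n::{finite,linorder}) vec"
    and L \<alpha> \<beta> \<gamma> \<sigma> u :: real
    and q0 p0 :: "(real, 'n) vec"
  assumes "3 \<le> CARD('n)"
    and "0 < \<alpha>" and "0 < \<beta>" and "0 < \<gamma>"
    and "standard_brownian_motion M W"
    and "mono (\<lambda>n. q0 $ n)" and "\<forall>n. 0 \<le> q0 $ n \<and> q0 $ n \<le> L"
    and "solves_agent_sde M W (quadratic_potential \<alpha>) \<beta> \<gamma> \<sigma> u (distances L q0) p0 Q p"
  shows "\<exists>\<nu> :: ((real, 'n) vec \<times> (real, 'n) vec) measure.
           gaussian_measure \<nu> \<and>
           integrable \<nu> (\<lambda>z. z) \<and>
           integral\<^sup>L \<nu> (\<lambda>z. z) = ((\<chi> n. L / real CARD('n)), 0) \<and>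
           converges_in_distribution M (\<lambda>t \<omega>. (Q t \<omega>, p t \<omega> - (\<chi> n. u))) \<nu> at_top"
proof -
  define B :: "((real, 'n) vec \<times> (real, 'n) vec) endo" where "B = Endo (drift \<alpha> \<beta> \<gamma>)"
  let ?g = "velocity_noise \<sigma> :: (real, 'n) vec \<Rightarrow> _"
  let ?z0 = "(distances L q0, p0 - (\<chi> n. u))"
  let ?Z = "\<lambda>t \<omega>. (Q t \<omega>, p t \<omega> - (\<chi> n. u))"
  let ?m = "((\<chi> n. L / real CARD('n)), 0) :: (real, 'n) vec \<times> (real, 'n) vec"
  obtain X where X: "brownian_version M W X"
    using brownian_version_exists[OF assms(5)] .
  obtain C c where "0 < c" and "\<And>t x. 0 \<le> t \<Longrightarrow> norm (flow B t \<cdot>\<^sub>E ?g x) \<le> C * exp (- c * t) * norm x"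
    "\<And>t x. 0 \<le> t \<Longrightarrow> norm ((flow B t * B) \<cdot>\<^sub>E ?g x) \<le> C * exp (- c * t) * norm x"
    using velocity_noise_decay[OF assms(2-4), of \<sigma>] unfolding B_def by blast
  then interpret stable_noise M W X B ?g C c
    by (intro stable_noise.intro X stable_noise_axioms.intro bounded_linear_velocity_noise)
  have meas: "?Z t \<in> borel_measurable M" if "0 \<le> t" for t
    using assms(8) that by (intro borel_measurable_Pair borel_measurable_diff)
      (auto simp: solves_agent_sde_def)
  \<comment> \<open>One null set serves all times. The noise part is written as
    \<open>path_functional\<close> of the path read backwards from \<open>t\<close>, the form to
    which reversal applies.\<close>
  have sde: "AE \<omega> in M. \<forall>t>0. ?Z t \<omega> =
      flow B t \<cdot>\<^sub>E ?z0 + path_functional B ?g t (\<lambda>s. X t \<omega> - X (t - s) \<omega>)"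
    using assms(8)[unfolded solves_agent_sde_def, THEN conjunct2] version AE_space
  proof eventually_elim
    case (elim \<omega>)
    show ?case
    proof (intro allI impI)
      fix t :: real assume "0 < t"
      have cont: "continuous_on {0..t} (\<lambda>s. X s \<omega>)"
        by (rule continuous_path[OF elim(3)])
      have "continuous_on {0..t} (\<lambda>s. ?Z s \<omega>)"
        using elim(1) by (intro continuous_intros) (auto elim: continuous_on_subset)
      moreover have "continuous_on {0..t} (\<lambda>s. ?g (X s \<omega>))"
        by (rule bounded_linear.continuous_on[OF bounded_linear_velocity_noise cont])
      moreover have "?Z s \<omega> = ?z0 + integral {0..s} (\<lambda>r. B \<cdot>\<^sub>E ?Z r \<omega>) + ?g (X s \<omega>)"
        if "s \<in> {0..t}" for s
      proof -
        have "?Z s \<omega> = ?z0 + integral {0..s} (\<lambda>r. B \<cdot>\<^sub>E ?Z r \<omega>) + ?g (W s \<omega>)"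
          unfolding B_def
          by (rule agent_sde_integral_equation[where Q="\<lambda>s. Q s \<omega>" and p="\<lambda>s. p s \<omega>" and W="\<lambda>s. W s \<omega>"])
             (use elim(1) that in auto)
        moreover have "X s \<omega> = W s \<omega>" using elim(2) that by simp
        ultimately show ?thesis by simp
      qed
      ultimately have "?Z t \<omega> = flow B t \<cdot>\<^sub>E ?z0 + ?g (X t \<omega>)
          + integral {0..t} (\<lambda>s. flow B (t - s) \<cdot>\<^sub>E B \<cdot>\<^sub>E ?g (X s \<omega>))"
        using \<open>0 < t\<close> by (intro duhamel) auto
      also have "\<dots> = flow B t \<cdot>\<^sub>E ?z0 + path_functional B ?g t (\<lambda>s. X t \<omega> - X (t - s) \<omega>)"
        using \<open>0 < t\<close> by (subst path_functional_reversed[OF bounded_linear_velocity_noise cont]) auto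
      finally show "?Z t \<omega> = flow B t \<cdot>\<^sub>E ?z0 + path_functional B ?g t (\<lambda>s. X t \<omega> - X (t - s) \<omega>)" .
    qed
  qed
  have mean: "((\<lambda>t. flow B t \<cdot>\<^sub>E ?z0) \<longlongrightarrow> ?m) at_top"
    unfolding B_def by (rule drift_flow_tendsto_equilibrium[OF assms(2-4)]) (simp add: sum_distances)
  define \<nu> where "\<nu> = distr M borel (\<lambda>\<omega>. ?m + limit_noise \<omega>)"
  have "converges_in_distribution M ?Z \<nu> at_top"
    unfolding converges_in_distribution_def
  proof (intro allI impI, elim conjE)
    fix f :: "(real, 'n) vec \<times> (real, 'n) vec \<Rightarrow> real"
    assume f: "continuous_on UNIV f" "bounded (range f)"
    have [measurable]: "f \<in> borel_measurable borel"
      using f(1) by (rule borel_measurable_continuous_onI)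
    have "(\<integral>\<omega>. f (flow B t \<cdot>\<^sub>E ?z0 + noise t \<omega>) \<partial>M) = integral\<^sup>L (distr M borel (?Z t)) f"
      if "0 < t" for t
    proof -
      \<comment> \<open>The deterministic part is absorbed into the test function, which stays
        bounded and continuous, so that reversal can be applied to the noise alone.\<close>
      let ?f = "\<lambda>x. f (flow B t \<cdot>\<^sub>E ?z0 + x)"
      have "continuous_on UNIV ?f"
        by (intro continuous_on_compose2[OF f(1)] continuous_intros) auto
      moreover have "bounded (range ?f)"
        using f(2) by (rule bounded_subset) auto
      ultimately have "(\<integral>\<omega>. ?f (noise t \<omega>) \<partial>M)
          = (\<integral>\<omega>. ?f (path_functional B ?g t (\<lambda>s. X t \<omega> - X (t - s) \<omega>)) \<partial>M)"
        by (rule noise_reversal[OF that, symmetric])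
      also have "\<dots> = (\<integral>\<omega>. f (?Z t \<omega>) \<partial>M)"
        using sde that measurable_reversed_noise[OF that] meas[of t]
        by (intro integral_cong_AE) (auto elim!: eventually_mono)
      also have "\<dots> = integral\<^sup>L (distr M borel (?Z t)) f"
        using that by (intro integral_distr[symmetric] meas) auto
      finally show ?thesis .
    qed
    then have "eventually (\<lambda>t. (\<integral>\<omega>. f (flow B t \<cdot>\<^sub>E ?z0 + noise t \<omega>) \<partial>M)
        = integral\<^sup>L (distr M borel (?Z t)) f) at_top"
      by (intro eventually_mono[OF eventually_gt_at_top[of 0]])
    moreover have "integral\<^sup>L \<nu> f = (\<integral>\<omega>. f (?m + limit_noise \<omega>) \<partial>M)"
      unfolding \<nu>_def by (rule integral_distr) measurable
    ultimately show "((\<lambda>t. integral\<^sup>L (distr M borel (?Z t)) f) \<longlongrightarrow> integral\<^sup>L \<nu> f) at_top"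
      using noise_converges_in_distribution[OF f mean] Lim_transform_eventually by fastforce
  qed
  moreover note gaussian_measure_distr_shift[OF measurable_limit_noise limit_noise_gaussian, of ?m,
      folded \<nu>_def]
  ultimately show ?thesis by blast
qed

end
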